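(* Let $N\ge 2$, let $a_1,\dots,a_N$ be pairwise distinct real numbers (the eigenvalues of a non-degenerate observable of an $N$-dimensional quantum system), and put $a_0=\min\{a_k-a_l : a_k>a_l\}>0$. Let $\hbar>0$, $\lambda>0$, $\alpha>0$ and $\beta=2\lambda/\alpha$. Let $\Psi_{Pr}\in L^2(\mathbb{R},dq)$ (initial probe state) and $\Phi_0\in L^2(\mathbb{R},db)$ (initial pointer state) be unit vectors, let $B$ be multiplication by $b$ on $L^2(\mathbb{R},db)$, and define the pointer states $$\rho_k=\int_{-\infty}^{\infty} dp\, |\langle p|\Psi_{Pr}\rangle|^2\; e^{\frac{i}{\hbar}(\lambda a_k-\beta p)B}\,|\Phi_0\rangle\langle\Phi_0|\,e^{-\frac{i}{\hbar}(\lambda a_k-\beta p)B},\qquad k=1,\dots,N.$$ Suppose that: (i) $\Psi_{Pr}$ is momentum limited with bound $\kappa_0>0$, and its momentum-space wave function $p\mapsto\langle p|\Psi_{Pr}\rangle$ is real-valued and of definite parity (even or odd), so that the function $F(\eta)=\int_{-\infty}^{\infty}|\langle p|\Psi_{Pr}\rangle|^2 e^{-i\beta p\eta/\hbar}\,dp$ is real and even; (ii) $\Phi_0$ is momentum limited with bound $b_0>0$, and $b\mapsto\langle b|\Phi_0\rangle=\Phi_0(b)$ is real-valued. If $$\lambda>\lambda_0=\frac{2\hbar b_0}{a_0}\qquad\text{and}\qquad \alpha>\alpha_0=\frac{4\hbar\kappa_0}{a_0-2\hbar b_0/\lambda},$$ then the pointer states are pairwise orthogonal: $\rho_k\rho_l=0$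 for all $k\neq l$. Moreover, when $\lambda>\lambda_0$ one has $\alpha_0>\alpha_D:=2\hbar\kappa_0/a_0$.
   Context: Inner products are linear in the second argument, and $|u\rangle\langle v|$ denotes the operator $w\mapsto\langle v|w\rangle u$. $\langle p|\Psi\rangle=(2\pi\hbar)^{-1/2}\int e^{-ipq/\hbar}\Psi(q)\,dq$ is the (unitary) momentum-space wave function of $\Psi\in L^2(\mathbb{R},dq)$. The integral defining $\rho_k$ is a trace-norm convergent (Bochner) integral of rank-one operators on $L^2(\mathbb{R},db)$. A function $\psi\in L^2(\mathbb{R})$ is momentum limited with bound $\kappa$ ($0<\kappa<\infty$) if $\psi(x)=\int_{-\kappa}^{\kappa}e^{ixk}\tilde\psi(k)\,dk$ for some $\tilde\psi\in L^2(-\kappa,\kappa)$. This is applied to $\Psi_{Pr}$ as a function of $q$ and to $\Phi_0$ as a function of $b$. *)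

theory Defs
  imports "HOL-Analysis.Analysis"
begin

section \<open>The complex Hilbert space of square-integrable functions on the line\<close>

definition L2_fun :: "'a measure \<Rightarrow> ('a \<Rightarrow> complex) set" where
  "L2_fun M = {f. f \<in> borel_measurable M \<and> integrable M (\<lambda>x. (cmod (f x))\<^sup>2)}"

definition L2_eq :: "(real \<Rightarrow> complex) \<Rightarrow> (real \<Rightarrow> complex) \<Rightarrow> bool" where
  "L2_eq f g \<longleftrightarrow> f \<in> L2_fun lborel \<and> g \<in> L2_fun lborel \<and> (AE x in lborel. f x = g x)"

lemma L2_fun_measurable [measurable_dest]: "f \<in> L2_fun M \<Longrightarrow> f \<in> borel_measurable M"
  by (simp add: L2_fun_def)

lemma L2_fun_zero: "(\<lambda>_. 0) \<in> L2_fun M"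
  by (simp add: L2_fun_def)

lemma L2_fun_mult_integrable:
  assumes f: "f \<in> L2_fun M" and g: "g \<in> L2_fun M"
  shows "integrable M (\<lambda>x. cnj (f x) * g x)"
proof (rule Bochner_Integration.integrable_bound)
  show "integrable M (\<lambda>x. (cmod (f x))\<^sup>2 + (cmod (g x))\<^sup>2)"
    using f g by (auto simp: L2_fun_def)
  have [measurable]: "f \<in> borel_measurable M" "g \<in> borel_measurable M"
    using f g by (auto simp: L2_fun_def)
  show "(\<lambda>x. cnj (f x) * g x) \<in> borel_measurable M"
    by (intro borel_measurable_times borel_measurable_continuous_on[where f = cnj])
       (auto intro: continuous_intros)
  have "a * b \<le> a\<^sup>2 + b\<^sup>2" if "a \<ge> 0" "b \<ge> 0" for a b :: real
    using sum_squares_bound[of a b] that mult_nonneg_nonneg[OF that] by linarith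
  then show "AE x in M. norm (cnj (f x) * g x) \<le> norm ((cmod (f x))\<^sup>2 + (cmod (g x))\<^sup>2)"
    by (auto simp: norm_mult)
qed

lemma L2_fun_add:
  assumes f: "f \<in> L2_fun M" and g: "g \<in> L2_fun M"
  shows "(\<lambda>x. f x + g x) \<in> L2_fun M"
proof -
  have [measurable]: "f \<in> borel_measurable M" "g \<in> borel_measurable M"
    using f g by (auto simp: L2_fun_def)
  have "integrable M (\<lambda>x. (cmod (f x + g x))\<^sup>2)"
  proof (rule Bochner_Integration.integrable_bound)
    show "integrable M (\<lambda>x. 2 * (cmod (f x))\<^sup>2 + 2 * (cmod (g x))\<^sup>2)"
      using f g by (auto simp: L2_fun_def)
    have "(cmod (a + b))\<^sup>2 \<le> 2 * (cmod a)\<^sup>2 + 2 * (cmod b)\<^sup>2" for a b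
    proof -
      have "(cmod (a + b))\<^sup>2 \<le> (cmod a + cmod b)\<^sup>2"
        by (intro power_mono norm_triangle_ineq) auto
      also have "\<dots> \<le> 2 * (cmod a)\<^sup>2 + 2 * (cmod b)\<^sup>2"
        using sum_squares_bound[of "cmod a" "cmod b"] by (simp add: power2_sum)
      finally show ?thesis .
    qed
    then show "AE x in M. norm ((cmod (f x + g x))\<^sup>2)
        \<le> norm (2 * (cmod (f x))\<^sup>2 + 2 * (cmod (g x))\<^sup>2)"
      by auto
  qed auto
  then show ?thesis by (auto simp: L2_fun_def)
qed

lemma L2_fun_bounded_mult:
  assumes f: "f \<in> L2_fun M" and g: "g \<in> borel_measurable M" and C: "\<And>x. cmod (g x) \<le> C"
  shows "(\<lambda>x. g x * f x) \<in> L2_fun M"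
proof -
  have [measurable]: "f \<in> borel_measurable M" "g \<in> borel_measurable M"
    using f g by (auto simp: L2_fun_def)
  have "integrable M (\<lambda>x. (cmod (g x * f x))\<^sup>2)"
  proof (rule Bochner_Integration.integrable_bound)
    show "integrable M (\<lambda>x. C\<^sup>2 * (cmod (f x))\<^sup>2)"
      using f by (auto simp: L2_fun_def)
    have "(cmod (g x * f x))\<^sup>2 \<le> C\<^sup>2 * (cmod (f x))\<^sup>2" for x
      using C[of x] by (auto simp: norm_mult power_mult_distrib intro!: mult_right_mono power_mono)
    then show "AE x in M. norm ((cmod (g x * f x))\<^sup>2) \<le> norm (C\<^sup>2 * (cmod (f x))\<^sup>2)"
      by auto
  qed auto
  then show ?thesis by (auto simp: L2_fun_def)
qed

lemma L2_fun_cmult: "f \<in> L2_fun M \<Longrightarrow> (\<lambda>x. c * f x) \<in> L2_fun M" for c :: complex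
  by (rule L2_fun_bounded_mult[where C = "cmod c"]) auto

quotient_type L2R = "real \<Rightarrow> complex" / partial: L2_eq
proof (rule part_equivpI)
  show "\<exists>f. L2_eq f f"
    using L2_fun_zero by (auto simp: L2_eq_def)
  show "symp L2_eq" "transp L2_eq"
    by (auto simp: symp_def transp_def L2_eq_def)
qed

lift_definition scaleC :: "complex \<Rightarrow> L2R \<Rightarrow> L2R" is "\<lambda>c f x. c * f x"
  by (auto simp: L2_eq_def intro: L2_fun_cmult)

lift_definition cinner :: "L2R \<Rightarrow> L2R \<Rightarrow> complex"
  is "\<lambda>f g. integral\<^sup>L lborel (\<lambda>x. cnj (f x) * g x)"
proof -
  fix f f' g g' assume "L2_eq f f'" "L2_eq g g'"
  then have "integrable lborel (\<lambda>x. cnj (f x) * g x)"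
       "integrable lborel (\<lambda>x. cnj (f' x) * g' x)"
       "AE x in lborel. f x = f' x" "AE x in lborel. g x = g' x"
    by (auto simp: L2_eq_def intro!: L2_fun_mult_integrable)
  then show "integral\<^sup>L lborel (\<lambda>x. cnj (f x) * g x) = integral\<^sup>L lborel (\<lambda>x. cnj (f' x) * g' x)"
    by (intro integral_cong_AE) auto
qed

instantiation L2R :: real_vector
begin

lift_definition zero_L2R :: L2R is "\<lambda>_. 0"
  by (simp add: L2_eq_def L2_fun_zero)

lift_definition plus_L2R :: "L2R \<Rightarrow> L2R \<Rightarrow> L2R" is "\<lambda>f g x. f x + g x"
  by (auto simp: L2_eq_def intro: L2_fun_add)

lift_definition uminus_L2R :: "L2R \<Rightarrow> L2R" is "\<lambda>f x. - f x"
  by (auto simp: L2_eq_def dest: L2_fun_cmult[where c = "-1"])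

definition minus_L2R :: "L2R \<Rightarrow> L2R \<Rightarrow> L2R" where "minus_L2R u v = u + (- v)"

definition scaleR_L2R :: "real \<Rightarrow> L2R \<Rightarrow> L2R" where
  "scaleR_L2R r u = scaleC (complex_of_real r) u"

instance
proof
  fix u v w :: L2R and r s :: real
  show "u + v + w = u + (v + w)"
    by transfer (auto simp: L2_eq_def add.assoc intro!: L2_fun_add)
  show "u + v = v + u"
    by transfer (auto simp: L2_eq_def add.commute intro!: L2_fun_add)
  show "0 + u = u"
    by transfer (auto simp: L2_eq_def)
  show "- u + u = 0"
    by transfer (auto simp: L2_eq_def L2_fun_zero)
  show "u - v = u + - v"
    by (rule minus_L2R_def)
  show "r *\<^sub>R (u + v) = r *\<^sub>R u + r *\<^sub>R v"
    unfolding scaleR_L2R_def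
    by transfer (auto simp: L2_eq_def distrib_left distrib_right intro!: L2_fun_add L2_fun_cmult)
  show "(r + s) *\<^sub>R u = r *\<^sub>R u + s *\<^sub>R u"
    unfolding scaleR_L2R_def
    by transfer (auto simp: L2_eq_def distrib_left distrib_right intro!: L2_fun_add L2_fun_cmult)
  show "r *\<^sub>R s *\<^sub>R u = (r * s) *\<^sub>R u"
    unfolding scaleR_L2R_def
    by transfer (auto simp: L2_eq_def mult.assoc intro!: L2_fun_cmult dest: L2_fun_cmult)
  show "1 *\<^sub>R u = u"
    unfolding scaleR_L2R_def by transfer (auto simp: L2_eq_def)
qed

end

lemma cinner_commute: "cinner u v = cnj (cinner v u)"
proof transfer
  fix f g :: "real \<Rightarrow> complex"
  have "cnj (integral\<^sup>L lborel (\<lambda>x. cnj (g x) * f x))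
      = integral\<^sup>L lborel (\<lambda>x. cnj (cnj (g x) * f x))"
    by (rule Bochner_Integration.integral_cnj[symmetric])
  then show "integral\<^sup>L lborel (\<lambda>x. cnj (f x) * g x)
      = cnj (integral\<^sup>L lborel (\<lambda>x. cnj (g x) * f x))"
    by (simp add: mult.commute del: Bochner_Integration.integral_cnj)
qed

lemma cinner_add_right: "cinner u (v + w) = cinner u v + cinner u w"
  by transfer (auto simp: L2_eq_def distrib_left L2_fun_mult_integrable)

lemma cinner_scaleC_right: "cinner u (scaleC c v) = c * cinner u v"
  by transfer (simp add: mult.left_commute)

lemma cinner_add_left: "cinner (u + v) w = cinner u w + cinner v w"
  using cinner_add_right cinner_commute by (metis complex_cnj_add)

lemma cinner_scaleC_left: "cinner (scaleC c u) v = cnj c * cinner u v"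
  using cinner_scaleC_right cinner_commute by (metis complex_cnj_mult)

lemma cinner_self_nonneg: "Re (cinner u u) \<ge> 0"
  and cinner_self_Im: "Im (cinner u u) = 0"
  and cinner_self_eq_zero: "Re (cinner u u) = 0 \<longleftrightarrow> u = 0"
proof -
  have *: "integral\<^sup>L lborel (\<lambda>x. cnj (f x) * f x) = complex_of_real (integral\<^sup>L lborel (\<lambda>x. (cmod (f x))\<^sup>2))"
    for f :: "real \<Rightarrow> complex"
    by (subst integral_complex_of_real[symmetric])
       (simp only: complex_norm_square mult.commute)
  show "Re (cinner u u) \<ge> 0"
    by transfer (simp add: *)
  show "Im (cinner u u) = 0"
    by transfer (simp add: *)
  show "Re (cinner u u) = 0 \<longleftrightarrow> u = 0"
  proof transfer
    fix f assume "L2_eq f f"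
    then have f: "f \<in> L2_fun lborel" by (simp add: L2_eq_def)
    then have "integral\<^sup>L lborel (\<lambda>x. (cmod (f x))\<^sup>2) = 0 \<longleftrightarrow> (AE x in lborel. (cmod (f x))\<^sup>2 = 0)"
      by (intro integral_nonneg_eq_0_iff_AE) (auto simp: L2_fun_def)
    then show "Re (integral\<^sup>L lborel (\<lambda>x. cnj (f x) * f x)) = 0 \<longleftrightarrow> L2_eq f (\<lambda>_. 0)"
      using f by (auto simp: * L2_eq_def L2_fun_zero)
  qed
qed

instantiation L2R :: real_inner
begin

definition inner_L2R :: "L2R \<Rightarrow> L2R \<Rightarrow> real" where "inner_L2R u v = Re (cinner u v)"

definition norm_L2R :: "L2R \<Rightarrow> real" where "norm_L2R u = sqrt (inner u u)"

definition dist_L2R :: "L2R \<Rightarrow> L2R \<Rightarrow> real" where "dist_L2R u v = norm (u - v)"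

definition sgn_L2R :: "L2R \<Rightarrow> L2R" where "sgn_L2R u = u /\<^sub>R norm u"

definition uniformity_L2R :: "(L2R \<times> L2R) filter" where
  "uniformity_L2R = (INF e\<in>{0<..}. principal {(u, v). dist u v < e})"

definition open_L2R :: "L2R set \<Rightarrow> bool" where
  "open_L2R U \<longleftrightarrow> (\<forall>x\<in>U. eventually (\<lambda>(x', y). x' = x \<longrightarrow> y \<in> U) uniformity)"

instance
proof
  fix u v w :: L2R and r :: real
  show "inner u v = inner v u"
    by (subst inner_L2R_def, subst cinner_commute) (simp add: inner_L2R_def)
  show "inner (u + v) w = inner u w + inner v w"
    by (simp add: inner_L2R_def cinner_add_left)
  show "inner (r *\<^sub>R u) v = r * inner u v"
    by (simp add: inner_L2R_def scaleR_L2R_def cinner_scaleC_left)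
  show "0 \<le> inner u u"
    by (simp add: inner_L2R_def cinner_self_nonneg)
  show "inner u u = 0 \<longleftrightarrow> u = 0"
    by (simp add: inner_L2R_def cinner_self_eq_zero)
qed (rule norm_L2R_def dist_L2R_def sgn_L2R_def uniformity_L2R_def open_L2R_def)+

end

lemma cinner_self: "cinner u u = complex_of_real ((norm u)\<^sup>2)"
  by (simp add: complex_eq_iff power2_norm_eq_inner inner_L2R_def cinner_self_Im)

lemma cinner_zero_left [simp]: "cinner 0 v = 0"
  and cinner_zero_right [simp]: "cinner v 0 = 0"
proof -
  show "cinner v 0 = 0" for v using cinner_add_right[of v 0 0] by simp
  then show "cinner 0 v = 0" using cinner_commute[of 0 v] by simp
qed

lemma cinner_minus_left: "cinner (- u) v = - cinner u v"
  and cinner_minus_right: "cinner v (- u) = - cinner v u"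
proof -
  show "cinner (- u) v = - cinner u v"
    using cinner_add_left[of u "- u" v] by (simp add: eq_neg_iff_add_eq_0 add.commute)
  show "cinner v (- u) = - cinner v u"
    using cinner_add_right[of v u "- u"] by (simp add: eq_neg_iff_add_eq_0 add.commute)
qed

lemma cinner_diff_left: "cinner (u - v) w = cinner u w - cinner v w"
  and cinner_diff_right: "cinner w (u - v) = cinner w u - cinner w v"
  by (simp_all only: diff_conv_add_uminus cinner_add_left cinner_add_right
      cinner_minus_left cinner_minus_right)

lemma scaleC_add_right: "scaleC c (u + v) = scaleC c u + scaleC c v"
  by transfer (auto simp: L2_eq_def distrib_left distrib_right intro!: L2_fun_add L2_fun_cmult)

lemma scaleC_add_left: "scaleC (c + d) u = scaleC c u + scaleC d u"
  by transfer (auto simp: L2_eq_def distrib_left distrib_right intro!: L2_fun_add L2_fun_cmult)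

lemma scaleC_scaleC: "scaleC c (scaleC d u) = scaleC (c * d) u"
  by transfer (auto simp: L2_eq_def mult.assoc intro!: L2_fun_cmult dest: L2_fun_cmult)

lemma scaleC_zero_right [simp]: "scaleC c 0 = 0"
  using scaleC_add_right[of c 0 0] by simp

lemma scaleC_uminus: "scaleC c (- u) = - scaleC c u"
  using scaleC_add_right[of c u "- u"] by (simp add: eq_neg_iff_add_eq_0 add.commute)

lemma scaleC_scaleR: "scaleC c (r *\<^sub>R u) = r *\<^sub>R scaleC c u"
  by (simp add: scaleR_L2R_def scaleC_scaleC mult.commute)


section \<open>Trace-class operators\<close>

definition clinear_op :: "(L2R \<Rightarrow> L2R) \<Rightarrow> bool" where
  "clinear_op T \<longleftrightarrow> (\<forall>u v. T (u + v) = T u + T v) \<and> (\<forall>c u. T (scaleC c u) = scaleC c (T u))"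

definition orthonormal :: "nat \<Rightarrow> (nat \<Rightarrow> L2R) \<Rightarrow> bool" where
  "orthonormal n e \<longleftrightarrow> (\<forall>i<n. \<forall>j<n. cinner (e i) (e j) = (if i = j then 1 else 0))"

text \<open>
  The trace norm is used in its variational form
  \<open>tr |T| = sup {\<Sum>i<n. |\<langle>e i|T (f i)\<rangle>|}\<close>, the supremum being taken over all finite orthonormal
  systems \<open>e\<close>, \<open>f\<close> of equal length; \<open>T\<close> is of trace class iff the supremum is finite. Systems of
  length one show that this includes boundedness of \<open>T\<close>.
\<close>

definition trace_sums :: "(L2R \<Rightarrow> L2R) \<Rightarrow> real set" where
  "trace_sums T = {(\<Sum>i<n. cmod (cinner (e i) (T (f i)))) | n e f. orthonormal n e \<and> orthonormal n f}"

lemma trace_sums_zero_mem: "0 \<in> trace_sums T"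
proof -
  have "(\<Sum>i<(0::nat). cmod (cinner (0::L2R) (T 0))) \<in> trace_sums T"
    unfolding trace_sums_def
    by (rule CollectI, rule exI[of _ 0]) (auto simp: orthonormal_def intro!: exI[of _ "\<lambda>_. 0"])
  then show ?thesis by simp
qed

typedef trace_class = "{T. clinear_op T \<and> bdd_above (trace_sums T)}"
proof
  show "(\<lambda>_. 0) \<in> {T. clinear_op T \<and> bdd_above (trace_sums T)}"
    by (auto simp: clinear_op_def trace_sums_def bdd_above_def)
qed

setup_lifting type_definition_trace_class

definition trace_norm :: "(L2R \<Rightarrow> L2R) \<Rightarrow> real" where
  "trace_norm T = Sup (trace_sums T)"

lemma trace_norm_upper:
  assumes "bdd_above (trace_sums T)" "orthonormal n e" "orthonormal n f"
  shows "(\<Sum>i<n. cmod (cinner (e i) (T (f i)))) \<le> trace_norm T"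
  unfolding trace_norm_def
  by (rule cSup_upper) (use assms in \<open>auto simp: trace_sums_def\<close>)

lemma trace_norm_least:
  assumes "\<And>n e f. orthonormal n e \<Longrightarrow> orthonormal n f \<Longrightarrow>
    (\<Sum>i<n. cmod (cinner (e i) (T (f i)))) \<le> C"
  shows "bdd_above (trace_sums T)" "trace_norm T \<le> C"
proof -
  have *: "x \<le> C" if "x \<in> trace_sums T" for x
    using that assms by (auto simp: trace_sums_def)
  then show "bdd_above (trace_sums T)" by (auto simp: bdd_above_def)
  show "trace_norm T \<le> C"
    unfolding trace_norm_def using * trace_sums_zero_mem by (intro cSup_least) auto
qed

lemma trace_sums_add_le:
  assumes "bdd_above (trace_sums S)" "bdd_above (trace_sums T)" "orthonormal n e" "orthonormal n f"
  shows "(\<Sum>i<n. cmod (cinner (e i) (S (f i) + T (f i)))) \<le> trace_norm S + trace_norm T"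
proof -
  have "(\<Sum>i<n. cmod (cinner (e i) (S (f i) + T (f i))))
      \<le> (\<Sum>i<n. cmod (cinner (e i) (S (f i))) + cmod (cinner (e i) (T (f i))))"
    by (intro sum_mono) (simp add: cinner_add_right norm_triangle_ineq)
  also have "\<dots> \<le> trace_norm S + trace_norm T"
    unfolding sum.distrib by (intro add_mono trace_norm_upper assms)
  finally show ?thesis .
qed

lemma trace_sums_scaleR:
  assumes "bdd_above (trace_sums T)" "orthonormal n e" "orthonormal n f"
  shows "(\<Sum>i<n. cmod (cinner (e i) (r *\<^sub>R T (f i)))) \<le> \<bar>r\<bar> * trace_norm T"
proof -
  have "(\<Sum>i<n. cmod (cinner (e i) (r *\<^sub>R T (f i)))) = \<bar>r\<bar> * (\<Sum>i<n. cmod (cinner (e i) (T (f i))))"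
    by (simp add: scaleR_L2R_def cinner_scaleC_right norm_mult sum_distrib_left)
  also have "\<dots> \<le> \<bar>r\<bar> * trace_norm T"
    by (intro mult_left_mono trace_norm_upper assms) auto
  finally show ?thesis .
qed

instantiation trace_class :: real_vector
begin

lift_definition zero_trace_class :: trace_class is "\<lambda>_. 0"
  by (auto simp: clinear_op_def trace_sums_def bdd_above_def)

lift_definition plus_trace_class :: "trace_class \<Rightarrow> trace_class \<Rightarrow> trace_class"
  is "\<lambda>S T u. S u + T u"
  by (auto simp: clinear_op_def scaleC_add_right intro!: trace_norm_least(1) trace_sums_add_le)

lift_definition scaleR_trace_class :: "real \<Rightarrow> trace_class \<Rightarrow> trace_class"
  is "\<lambda>r T u. r *\<^sub>R T u"
  by (auto simp: clinear_op_def scaleC_scaleR scaleR_add_right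
           intro!: trace_norm_least(1) trace_sums_scaleR)

definition uminus_trace_class :: "trace_class \<Rightarrow> trace_class" where
  "uminus_trace_class T = (-1) *\<^sub>R T"

definition minus_trace_class :: "trace_class \<Rightarrow> trace_class \<Rightarrow> trace_class" where
  "minus_trace_class S T = S + (- T)"

instance
proof
  fix R S T :: trace_class and r s :: real
  show "R + S + T = R + (S + T)" by transfer (simp add: add.assoc)
  show "R + S = S + R" by transfer (simp add: add.commute)
  show "0 + R = R" by transfer simp
  show "- R + R = 0" unfolding uminus_trace_class_def by transfer simp
  show "R - S = R + - S" by (rule minus_trace_class_def)
  show "r *\<^sub>R (R + S) = r *\<^sub>R R + r *\<^sub>R S" by transfer (simp add: scaleR_add_right)
  show "(r + s) *\<^sub>R R = r *\<^sub>R R + s *\<^sub>R R" by transfer (simp add: scaleR_add_left)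
  show "r *\<^sub>R s *\<^sub>R R = (r * s) *\<^sub>R R" by transfer simp
  show "1 *\<^sub>R R = R" by transfer simp
qed

end

instantiation trace_class :: real_normed_vector
begin

lift_definition norm_trace_class :: "trace_class \<Rightarrow> real" is trace_norm .

definition dist_trace_class :: "trace_class \<Rightarrow> trace_class \<Rightarrow> real" where
  "dist_trace_class S T = norm (S - T)"

definition sgn_trace_class :: "trace_class \<Rightarrow> trace_class" where
  "sgn_trace_class T = T /\<^sub>R norm T"

definition uniformity_trace_class :: "(trace_class \<times> trace_class) filter" where
  "uniformity_trace_class = (INF e\<in>{0<..}. principal {(S, T). dist S T < e})"

definition open_trace_class :: "trace_class set \<Rightarrow> bool" where
  "open_trace_class U \<longleftrightarrow> (\<forall>x\<in>U. eventually (\<lambda>(x', y). x' = x \<longrightarrow> y \<in> U) uniformity)"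

instance
proof
  fix S T :: trace_class and r :: real
  show "norm (S + T) \<le> norm S + norm T"
    by transfer (auto intro!: trace_norm_least(2) trace_sums_add_le)
  have le: "norm (r *\<^sub>R T) \<le> \<bar>r\<bar> * norm T" for r and T :: trace_class
    by transfer (auto intro!: trace_norm_least(2) trace_sums_scaleR)
  show "norm (r *\<^sub>R T) = \<bar>r\<bar> * norm T"
  proof (cases "r = 0")
    case True
    have "norm (0 :: trace_class) \<le> 0"
      by transfer (rule trace_norm_least(2), simp)
    moreover have "norm (0 :: trace_class) \<ge> 0"
      by transfer (use trace_norm_upper[of "\<lambda>_. 0" 0] in
          \<open>auto simp: orthonormal_def trace_sums_def bdd_above_def\<close>)
    ultimately show ?thesis using True by simp
  next
    case False
    have "\<bar>r\<bar> * norm T = \<bar>r\<bar> * norm (inverse r *\<^sub>R r *\<^sub>R T)" using False by simp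
    also have "\<dots> \<le> \<bar>r\<bar> * (\<bar>inverse r\<bar> * norm (r *\<^sub>R T))" by (intro mult_left_mono le) auto
    also have "\<dots> = norm (r *\<^sub>R T)" using False by (simp add: field_simps)
    finally show ?thesis using le[of r T] by simp
  qed
  show "norm T = 0 \<longleftrightarrow> T = 0"
  proof
    assume "T = 0"
    have "norm (0 :: trace_class) \<le> 0"
      by transfer (rule trace_norm_least(2), simp)
    moreover have "norm (0 :: trace_class) \<ge> 0"
      by transfer (use trace_norm_upper[of "\<lambda>_. 0" 0] in
          \<open>auto simp: orthonormal_def trace_sums_def bdd_above_def\<close>)
    ultimately show "norm T = 0" using \<open>T = 0\<close> by simp
  next
    show "norm T = 0 \<Longrightarrow> T = 0"
    proof transfer
      fix T assume "clinear_op T \<and> bdd_above (trace_sums T)" and T0: "trace_norm T = 0"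
      then have lin: "\<And>c u. T (scaleC c u) = scaleC c (T u)" and bdd: "bdd_above (trace_sums T)"
        by (auto simp: clinear_op_def)
      have linR: "T (r *\<^sub>R u) = r *\<^sub>R T u" for r u by (simp add: scaleR_L2R_def lin)
      have unit: "orthonormal 1 (\<lambda>_. u /\<^sub>R norm u)" if "u \<noteq> 0" for u
        using that by (simp add: orthonormal_def cinner_self)
      have "T u = 0" for u
      proof (rule ccontr)
        assume "T u \<noteq> 0"
        moreover have "T 0 = 0" using linR[of 0 0] by simp
        ultimately have u: "u \<noteq> 0" "T u \<noteq> 0" by auto
        have "(\<Sum>i<(1::nat). cmod (cinner (T u /\<^sub>R norm (T u)) (T (u /\<^sub>R norm u)))) \<le> trace_norm T"
          by (rule trace_norm_upper[OF bdd unit[OF u(2)] unit[OF u(1)]])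
        moreover have "cinner (T u /\<^sub>R norm (T u)) (T (u /\<^sub>R norm u))
            = complex_of_real (norm (T u) / norm u)"
          using u by (simp only: linR) (simp add: scaleR_L2R_def cinner_scaleC_left
              cinner_scaleC_right cinner_self power2_eq_square field_simps)
        ultimately have "norm (T u) / norm u \<le> 0"
          using T0 by (simp del: of_real_divide)
        then show False using u by (simp add: divide_le_0_iff)
      qed
      then show "T = (\<lambda>_. 0)" by auto
    qed
  qed
qed (rule dist_trace_class_def sgn_trace_class_def uniformity_trace_class_def open_trace_class_def)+

end

lemma bessel_inequality:
  assumes "orthonormal n e"
  shows "(\<Sum>i<n. (cmod (cinner (e i) u))\<^sup>2) \<le> (norm u)\<^sup>2"
proof -
  define s where "s m = (\<Sum>i<m. scaleC (cinner (e i) u) (e i))" for m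
  have orth: "cinner (e j) (s m) = (if j < m then cinner (e j) u else 0)" if "m \<le> n" "j < n" for j m
    using that
  proof (induction m)
    case 0
    then show ?case by (simp add: s_def)
  next
    case (Suc m)
    then have "cinner (e j) (e m) = (if j = m then 1 else 0)"
      using assms by (auto simp: orthonormal_def)
    with Suc show ?case
      by (auto simp: s_def cinner_add_right cinner_scaleC_right less_Suc_eq)
  qed
  have "(norm (u - s m))\<^sup>2 = (norm u)\<^sup>2 - (\<Sum>i<m. (cmod (cinner (e i) u))\<^sup>2)" if "m \<le> n" for m
    using that
  proof (induction m)
    case 0
    then show ?case by (simp add: s_def)
  next
    case (Suc m)
    define c where "c = cinner (e m) u"
    have e: "cinner (e m) (e m) = 1" and em: "cinner (e m) (u - s m) = c"
      using Suc.prems assms orth[of m m] by (auto simp: orthonormal_def cinner_diff_right c_def)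
    have em': "cinner (u - s m) (e m) = cnj c"
      using em cinner_commute by metis
    have "u - s (Suc m) = (u - s m) - scaleC c (e m)" by (simp add: s_def c_def)
    then have "cinner (u - s (Suc m)) (u - s (Suc m)) =
        cinner (u - s m) (u - s m) - c * cnj c"
      using e em em' by (simp only: cinner_diff_left[of "u - s m"] cinner_diff_right[of _ "u - s m"]
          cinner_scaleC_left cinner_scaleC_right) (simp add: algebra_simps)
    then have "complex_of_real ((norm (u - s (Suc m)))\<^sup>2) =
        complex_of_real ((norm (u - s m))\<^sup>2 - (cmod c)\<^sup>2)"
      unfolding cinner_self of_real_diff complex_norm_square .
    then have "(norm (u - s (Suc m)))\<^sup>2 = (norm (u - s m))\<^sup>2 - (cmod c)\<^sup>2"
      unfolding of_real_eq_iff .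
    with Suc show ?case by (simp add: c_def)
  qed
  from this[of n] show ?thesis
    using zero_le_power2[of "norm (u - s n)"] by linarith
qed

lift_definition ketbra :: "L2R \<Rightarrow> L2R \<Rightarrow> trace_class" is "\<lambda>u v w. scaleC (cinner v w) u"
proof (intro conjI)
  fix u v :: L2R
  show "clinear_op (\<lambda>w. scaleC (cinner v w) u)"
    by (auto simp: clinear_op_def cinner_add_right cinner_scaleC_right scaleC_add_left scaleC_scaleC)
  show "bdd_above (trace_sums (\<lambda>w. scaleC (cinner v w) u))"
  proof (rule trace_norm_least(1))
    fix n e f assume ef: "orthonormal n e" "orthonormal n f"
    have le: "2 * (x * y) \<le> x\<^sup>2 + y\<^sup>2" for x y :: real
      using sum_squares_bound[of x y] by simp
    have "2 * (\<Sum>i<n. cmod (cinner (e i) (scaleC (cinner v (f i)) u)))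
        = (\<Sum>i<n. 2 * (cmod (cinner (f i) v) * cmod (cinner (e i) u)))"
      unfolding cinner_scaleC_right norm_mult sum_distrib_left
      by (subst cinner_commute[of v]) simp
    also have "\<dots> \<le> (\<Sum>i<n. (cmod (cinner (f i) v))\<^sup>2 + (cmod (cinner (e i) u))\<^sup>2)"
      by (intro sum_mono le)
    also have "\<dots> \<le> (norm v)\<^sup>2 + (norm u)\<^sup>2"
      unfolding sum.distrib by (intro add_mono bessel_inequality ef)
    finally show "(\<Sum>i<n. cmod (cinner (e i) (scaleC (cinner v (f i)) u)))
        \<le> ((norm v)\<^sup>2 + (norm u)\<^sup>2) / 2"
      by simp
  qed
qed

text \<open>
  The library integral \<^const>\<open>lebesgue_integral\<close> is only available for second-countable value types,
  so the Bochner integral is defined here for arbitrary normed value types. As usual, strong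
  measurability (being almost everywhere a limit of simple functions) is part of the definition.
\<close>

definition has_bochner_int :: "'a measure \<Rightarrow> ('a \<Rightarrow> 'b::real_normed_vector) \<Rightarrow> 'b \<Rightarrow> bool" where
  "has_bochner_int M f x \<longleftrightarrow>
     (\<exists>s. (\<forall>i. Bochner_Integration.simple_bochner_integrable M (s i))
        \<and> (AE t in M. (\<lambda>i. s i t) \<longlonglongrightarrow> f t)
        \<and> (\<lambda>i. \<integral>\<^sup>+ t. ennreal (norm (f t - s i t)) \<partial>M) \<longlonglongrightarrow> 0
        \<and> (\<lambda>i. Bochner_Integration.simple_bochner_integral M (s i)) \<longlonglongrightarrow> x)"

definition bochner_int :: "'a measure \<Rightarrow> ('a \<Rightarrow> 'b::real_normed_vector) \<Rightarrow> 'b" where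
  "bochner_int M f = (THE x. has_bochner_int M f x)"


section \<open>Wave functions and pointer states\<close>

text \<open>
  The momentum-space wave function of a square-integrable function is its Fourier-Plancherel
  transform, i.e. the limit in the \<open>L\<^sup>2\<close> norm of the truncated Fourier integrals.
\<close>

definition momentum_trunc :: "real \<Rightarrow> L2R \<Rightarrow> nat \<Rightarrow> L2R" where
  "momentum_trunc hbar Psi n =
     abs_L2R (\<lambda>p. complex_of_real (1 / sqrt (2 * pi * hbar)) *
       (LINT q:{- real n..real n}|lborel.
          exp (- (\<i> * complex_of_real (p * q / hbar))) * rep_L2R Psi q))"

definition momentum_wf :: "real \<Rightarrow> L2R \<Rightarrow> real \<Rightarrow> complex" where
  "momentum_wf hbar Psi = rep_L2R (lim (momentum_trunc hbar Psi))"

definition momentum_limited :: "real \<Rightarrow> L2R \<Rightarrow> bool" where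
  "momentum_limited \<kappa> \<psi> \<longleftrightarrow> 0 < \<kappa> \<and>
     (\<exists>g \<in> L2_fun (restrict_space lborel {- \<kappa><..<\<kappa>}).
        AE x in lborel. rep_L2R \<psi> x =
          (LINT k|restrict_space lborel {- \<kappa><..<\<kappa>}. exp (\<i> * complex_of_real (x * k)) * g k))"

text \<open>
  The operator \<open>g(B)\<close>, where \<open>B\<close> is multiplication by the variable \<open>b\<close>: the functional calculus
  of a multiplication operator is again multiplication.
\<close>

definition fun_of_B :: "(real \<Rightarrow> complex) \<Rightarrow> L2R \<Rightarrow> L2R" where
  "fun_of_B g u = abs_L2R (\<lambda>b. g b * rep_L2R u b)"

definition exp_iB :: "real \<Rightarrow> L2R \<Rightarrow> L2R" where
  "exp_iB t = fun_of_B (\<lambda>b. exp (\<i> * complex_of_real (t * b)))"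

lemma fun_of_B_abs:
  assumes "f \<in> L2_fun lborel" "g \<in> borel_measurable lborel" "\<And>b. cmod (g b) \<le> C"
  shows "fun_of_B g (abs_L2R f) = abs_L2R (\<lambda>b. g b * f b)"
proof -
  have "L2_eq f f" using assms by (simp add: L2_eq_def)
  then have "L2_eq (rep_L2R (abs_L2R f)) f"
    using Quotient_L2R by (metis Quotient_rep_abs)
  then have "L2_eq (\<lambda>b. g b * rep_L2R (abs_L2R f) b) (\<lambda>b. g b * f b)"
    using assms by (auto simp: L2_eq_def intro!: L2_fun_bounded_mult)
  then show ?thesis
    unfolding fun_of_B_def using Quotient_L2R by (metis Quotient_rel)
qed

lemma exp_iB_abs:
  assumes "f \<in> L2_fun lborel"
  shows "exp_iB t (abs_L2R f) = abs_L2R (\<lambda>b. exp (\<i> * complex_of_real (t * b)) * f b)"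
  unfolding exp_iB_def
  by (rule fun_of_B_abs[where C = 1, OF assms]) (auto simp: borel_measurable_exp)

lemma L2R_cases:
  obtains f where "f \<in> L2_fun lborel" "u = abs_L2R f"
proof -
  have "L2_eq (rep_L2R u) (rep_L2R u)" "abs_L2R (rep_L2R u) = u"
    using Quotient_L2R by (metis Quotient_rep_reflp, metis Quotient_abs_rep)
  then show ?thesis using that[of "rep_L2R u"] by (simp add: L2_eq_def)
qed

lemma cinner_abs:
  assumes "f \<in> L2_fun lborel" "g \<in> L2_fun lborel"
  shows "cinner (abs_L2R f) (abs_L2R g) = integral\<^sup>L lborel (\<lambda>x. cnj (f x) * g x)"
  using assms by (intro cinner.abs_eq) (auto simp: L2_eq_def)

lemma exp_iB_adjoint: "cinner u (exp_iB (- t) w) = cinner (exp_iB t u) w"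
proof -
  have *: "(\<lambda>b. exp (\<i> * complex_of_real (s * b)) * f b) \<in> L2_fun lborel"
    if "f \<in> L2_fun lborel" for f s
    by (rule L2_fun_bounded_mult[where C = 1, OF that]) (auto simp: borel_measurable_exp)
  obtain f g where fg: "f \<in> L2_fun lborel" "u = abs_L2R f" "g \<in> L2_fun lborel" "w = abs_L2R g"
    using L2R_cases by metis
  show ?thesis
    unfolding fg exp_iB_abs[OF fg(1)] exp_iB_abs[OF fg(3)]
      cinner_abs[OF fg(1) *[OF fg(3)]] cinner_abs[OF *[OF fg(1)] fg(3)]
    by (simp add: exp_cnj mult.assoc mult.left_commute)
qed

lemma exp_iB_scaleC: "exp_iB t (scaleC c u) = scaleC c (exp_iB t u)"
proof -
  obtain f where f: "f \<in> L2_fun lborel" "u = abs_L2R f" using L2R_cases by metis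
  have *: "(\<lambda>b. exp (\<i> * complex_of_real (t * b)) * f b) \<in> L2_fun lborel"
    by (rule L2_fun_bounded_mult[where C = 1, OF f(1)]) (auto simp: borel_measurable_exp)
  have "scaleC c (abs_L2R h) = abs_L2R (\<lambda>x. c * h x)" if "h \<in> L2_fun lborel" for h
    using that by (intro scaleC.abs_eq) (simp add: L2_eq_def)
  then show ?thesis
    using f * by (simp add: exp_iB_abs L2_fun_cmult mult.left_commute)
qed

text \<open>The conjugated rank-one operator \<open>exp(itB) |u\<rangle>\<langle>v| exp(-itB)\<close>.\<close>

definition conj_ketbra :: "real \<Rightarrow> L2R \<Rightarrow> L2R \<Rightarrow> trace_class" where
  "conj_ketbra t u v = Abs_trace_class (exp_iB t \<circ> Rep_trace_class (ketbra u v) \<circ> exp_iB (- t))"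

text \<open>
  The composition in \<^const>\<open>conj_ketbra\<close> is of trace class, so it is indeed what
  \<^const>\<open>Abs_trace_class\<close> represents.
\<close>

lemma conj_ketbra_eq: "conj_ketbra t u v = ketbra (exp_iB t u) (exp_iB t v)"
  and Rep_conj_ketbra:
    "Rep_trace_class (conj_ketbra t u v) = exp_iB t \<circ> Rep_trace_class (ketbra u v) \<circ> exp_iB (- t)"
proof -
  have *: "exp_iB t \<circ> Rep_trace_class (ketbra u v) \<circ> exp_iB (- t)
      = Rep_trace_class (ketbra (exp_iB t u) (exp_iB t v))"
    by (auto simp: fun_eq_iff ketbra.rep_eq exp_iB_scaleC exp_iB_adjoint)
  show "conj_ketbra t u v = ketbra (exp_iB t u) (exp_iB t v)"
    by (simp add: conj_ketbra_def * Rep_trace_class_inverse)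
  then show "Rep_trace_class (conj_ketbra t u v)
      = exp_iB t \<circ> Rep_trace_class (ketbra u v) \<circ> exp_iB (- t)"
    by (simp add: *)
qed

definition pointer_state :: "real \<Rightarrow> real \<Rightarrow> real \<Rightarrow> L2R \<Rightarrow> L2R \<Rightarrow> real \<Rightarrow> trace_class" where
  "pointer_state hbar lam \<beta> Psi Phi x =
     bochner_int lborel (\<lambda>p. (cmod (momentum_wf hbar Psi p))\<^sup>2 *\<^sub>R
       conj_ketbra ((lam * x - \<beta> * p) / hbar) Phi Phi)"

definition charF :: "real \<Rightarrow> real \<Rightarrow> L2R \<Rightarrow> real \<Rightarrow> complex" where
  "charF hbar \<beta> Psi \<eta> =
     (LINT p|lborel. complex_of_real ((cmod (momentum_wf hbar Psi p))\<^sup>2) *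
        exp (- (\<i> * complex_of_real (\<beta> * p * \<eta> / hbar))))"

end

(*
  Conjugating Phi_0 by exp(itB) translates its momentum support, contained in [-b0, b0], by t, and
  |<p|Psi>|^2 vanishes for |p| > hbar kappa_0. Hence rho_k only involves vectors with momentum
  support in an interval around lambda a_k / hbar of half-width beta kappa_0 + b0, and the
  hypotheses on lambda and alpha say precisely that these intervals are disjoint. Everything that
  is needed from Fourier analysis (orthogonality of Fourier integrals of functions with separated
  supports, and the L^2 bound of the Plancherel theorem) follows from inserting a Gaussian weight
  and letting it tend to 1. Completeness of L^2 and of the trace class makes the limits defining
  the momentum wave function and the Bochner integral exist.
*)

theory Submission
  imports Defs "HOL-Probability.Characteristic_Functions" "HOL-Real_Asymp.Real_Asymp"
begin

text \<open>The weight is there because a product of two Fourier integrals is not absolutely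
  integrable jointly in position and both frequencies, so Fubini cannot be applied to it directly. A
  Gaussian is chosen because its transform is explicit: 2 pi times a normal density of width
  \<open>s\<close> in the frequency difference. As \<open>s\<close> tends to 0 this kernel vanishes
  away from the diagonal, which gives orthogonality, while its mass stays 1, which gives the L^2
  bound. Cutting \<open>Psi\<close> off in position destroys its band limit, so the vanishing of the
  momentum wave function cannot be read off the truncations that define it. It is obtained by
  duality: the limit is tested against functions living outside the band, and the transform is moved
  onto the test function. \<open>bochner_int\<close> is a definite description and its values lie in
  a space that need not be separable. Existence is therefore proved from simple approximants, and
  everything else, uniqueness and the product of two states included, is reduced to matrix elements,
  which are scalar integrals.\<close>

lemma cmod_iexp [simp]: "cmod (exp (\<i> * complex_of_real x)) = 1"
  by (simp add: norm_exp_i_times)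

lemma iexp_measurable [measurable]: "(\<lambda>x. exp (\<i> * complex_of_real x)) \<in> borel_measurable borel"
  by (intro borel_measurable_continuous_onI continuous_intros)

lemma cnj_measurable [measurable]: "cnj \<in> borel_measurable borel"
  by (intro borel_measurable_continuous_onI continuous_intros)

lemma (in pair_sigma_finite) integrable_mult_fst_snd:
  fixes f g :: "_ \<Rightarrow> 'c::{banach, second_countable_topology, real_normed_div_algebra}"
  assumes f: "integrable M1 f" and g: "integrable M2 g"
  shows "integrable (M1 \<Otimes>\<^sub>M M2) (\<lambda>z. f (fst z) * g (snd z))"
proof (rule Fubini_integrable)
  have [measurable]: "f \<in> borel_measurable M1" "g \<in> borel_measurable M2" using f g by auto
  show "(\<lambda>z. f (fst z) * g (snd z)) \<in> borel_measurable (M1 \<Otimes>\<^sub>M M2)" by measurable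
  show "integrable M1 (\<lambda>x. LINT y|M2. norm (f (fst (x, y)) * g (snd (x, y))))"
    using f by (simp add: norm_mult)
  show "AE x in M1. integrable M2 (\<lambda>y. f (fst (x, y)) * g (snd (x, y)))"
    using g by simp
qed

lemma (in pair_sigma_finite) integral_mult_fst_snd:
  fixes f g :: "_ \<Rightarrow> 'c::{banach, second_countable_topology, real_normed_field}"
  assumes f: "integrable M1 f" and g: "integrable M2 g"
  shows "(LINT z|(M1 \<Otimes>\<^sub>M M2). f (fst z) * g (snd z)) = (LINT x|M1. f x) * (LINT y|M2. g y)"
  using integral_fst'[OF integrable_mult_fst_snd[OF f g]] by simp

subsection \<open>Fourier integrals\<close>

text \<open>Sign and normalisation are those of \<open>momentum_limited\<close>: no factor 1/sqrt(2
  pi), hence the 2 pi in the L^2 bounds below.\<close>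

definition fourier :: "(real \<Rightarrow> complex) \<Rightarrow> real \<Rightarrow> complex" where
  "fourier g x = (LINT k|lborel. exp (\<i> * complex_of_real (x * k)) * g k)"

lemma fourier_integrand_integrable:
  assumes "integrable lborel g"
  shows "integrable lborel (\<lambda>k. exp (\<i> * complex_of_real (x * k)) * g k)"
proof (rule Bochner_Integration.integrable_bound[OF assms])
  have [measurable]: "g \<in> borel_measurable lborel" using assms by simp
  show "(\<lambda>k. exp (\<i> * complex_of_real (x * k)) * g k) \<in> borel_measurable lborel" by measurable
qed (simp add: norm_mult)

lemma fourier_measurable [measurable]:
  assumes [measurable]: "g \<in> borel_measurable borel"
  shows "fourier g \<in> borel_measurable borel"
  unfolding fourier_def by measurable

section \<open>Parseval's identity with a Gaussian weight\<close>

lemma gaussian_integrable: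
  assumes "0 < s"
  shows "integrable lborel (\<lambda>x::real. exp (- (s * x)\<^sup>2 / 2))"
proof -
  have "integrable lborel (\<lambda>x. sqrt (2 * pi) * normal_density 0 1 (0 + s * x))"
    using assms by (intro integrable_mult_right lborel_integrable_real_affine) auto
  then show ?thesis by (simp add: std_normal_density_def)
qed

text \<open>This is the characteristic function of the standard normal distribution at
  \<open>t / s\<close>, after the substitution of \<open>s * x\<close> for the variable. Written as
  a normal density of deviation \<open>s\<close>, the result visibly has mass 2 pi and concentrates
  at 0 for small \<open>s\<close>.\<close>

lemma fourier_gaussian:
  assumes "0 < s"
  shows "fourier (\<lambda>x. complex_of_real (exp (- (s * x)\<^sup>2 / 2))) t
    = complex_of_real (2 * pi * normal_density 0 s t)"
proof -
  have "complex_of_real (exp (- (t / s)\<^sup>2 / 2)) = char std_normal_distribution (t / s)"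
    by (simp add: char_std_normal_distribution)
  also have "\<dots> = (LINT x|lborel. std_normal_density x *\<^sub>R exp (\<i> * complex_of_real (t / s * x)))"
    unfolding char_def by (subst integral_density) (auto simp: normal_density_nonneg)
  also have "\<dots> = s *\<^sub>R (LINT x|lborel. std_normal_density (0 + s * x) *\<^sub>R
      exp (\<i> * complex_of_real (t / s * (0 + s * x))))"
    using assms by (subst lborel_integral_real_affine[of s _ 0]) auto
  also have "\<dots> = complex_of_real (s / sqrt (2 * pi)) *
      fourier (\<lambda>x. complex_of_real (exp (- (s * x)\<^sup>2 / 2))) t"
    unfolding fourier_def integral_mult_right_zero[symmetric] integral_scaleR_right[symmetric]
    using assms by (intro Bochner_Integration.integral_cong refl)
      (simp add: std_normal_density_def scaleR_conv_of_real)
  finally have "fourier (\<lambda>x. complex_of_real (exp (- (s * x)\<^sup>2 / 2))) t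
      = complex_of_real (sqrt (2 * pi) / s * exp (- (t / s)\<^sup>2 / 2))"
    using assms by (simp add: field_simps)
  also have "sqrt (2 * pi) / s * exp (- (t / s)\<^sup>2 / 2) = 2 * pi * normal_density 0 s t"
    using assms by (simp add: normal_density_def real_sqrt_mult field_simps power2_eq_square)
  finally show ?thesis .
qed

lemma fourier_mult_cnj:
  assumes g: "integrable lborel g" and h: "integrable lborel h"
  shows "fourier g x * cnj (fourier h x) = (LINT z|(lborel \<Otimes>\<^sub>M lborel).
    exp (\<i> * complex_of_real (x * (fst z - snd z))) * (g (fst z) * cnj (h (snd z))))"
proof -
  have *: "integrable lborel (\<lambda>k. exp (\<i> * complex_of_real (x * k)) * g k)"
    "integrable lborel (\<lambda>k. cnj (exp (\<i> * complex_of_real (x * k)) * h k))"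
    using g h by (intro fourier_integrand_integrable integrable_cnj; simp)+
  have "exp (\<i> * complex_of_real (x * (k - k'))) * (g k * cnj (h k'))
     = exp (\<i> * complex_of_real (x * k)) * g k * cnj (exp (\<i> * complex_of_real (x * k')) * h k')" for k k'
    by (simp add: exp_cnj algebra_simps flip: exp_add)
  then show ?thesis
    unfolding fourier_def
    by (simp only: lborel_pair.integral_mult_fst_snd[OF *] Bochner_Integration.integral_cnj)
qed

text \<open>The weight makes the triple integral over position and both frequencies absolutely
  convergent. Integrating over position first then replaces the exponential of the frequency
  difference by the kernel of \<open>fourier_gaussian\<close>.\<close>

lemma gaussian_parseval:
  assumes g: "integrable lborel g" and h: "integrable lborel h" and s: "0 < s"
  shows "(LINT x|lborel. complex_of_real (exp (- (s * x)\<^sup>2 / 2)) * (fourier g x * cnj (fourier h x)))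
     = (LINT z|(lborel \<Otimes>\<^sub>M lborel).
          complex_of_real (2 * pi * normal_density 0 s (fst z - snd z)) * (g (fst z) * cnj (h (snd z))))"
proof -
  define w where "w x = complex_of_real (exp (- (s * x)\<^sup>2 / 2))" for x
  define K where "K z = g (fst z) * cnj (h (snd z))" for z
  have [measurable]: "g \<in> borel_measurable lborel" "h \<in> borel_measurable lborel" using g h by auto
  have w: "integrable lborel w"
    unfolding w_def by (intro integrable_of_real gaussian_integrable s)
  have K: "integrable (lborel \<Otimes>\<^sub>M lborel) K"
    unfolding K_def using g h by (intro lborel_pair.integrable_mult_fst_snd integrable_cnj)
  note [measurable] = borel_measurable_integrable[OF w] borel_measurable_integrable[OF K]
  interpret L2: sigma_finite_measure "lborel \<Otimes>\<^sub>M lborel :: (real \<times> real) measure"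
    by (simp add: lborel_prod lborel.sigma_finite_measure_axioms)
  interpret P: pair_sigma_finite lborel "lborel \<Otimes>\<^sub>M lborel :: (real \<times> real) measure" ..
  define F where "F x z = w x * (exp (\<i> * complex_of_real (x * (fst z - snd z))) * K z)"
    for x and z :: "real \<times> real"
  have "integrable (lborel \<Otimes>\<^sub>M (lborel \<Otimes>\<^sub>M lborel)) (case_prod F)"
  proof (rule Bochner_Integration.integrable_bound[OF P.integrable_mult_fst_snd[OF w K]])
    show "case_prod F \<in> borel_measurable (lborel \<Otimes>\<^sub>M (lborel \<Otimes>\<^sub>M lborel))"
      unfolding F_def by measurable
  qed (auto simp: F_def norm_mult)
  then have "(LINT x|lborel. LINT z|(lborel \<Otimes>\<^sub>M lborel). F x z)
      = (LINT z|(lborel \<Otimes>\<^sub>M lborel). LINT x|lborel. F x z)"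
    by (rule P.Fubini_integral[symmetric])
  moreover have "(LINT z|(lborel \<Otimes>\<^sub>M lborel). F x z) = w x * (fourier g x * cnj (fourier h x))" for x
    unfolding F_def K_def fourier_mult_cnj[OF g h] by (rule integral_mult_right_zero)
  moreover have "(LINT x|lborel. F x z) = complex_of_real (2 * pi * normal_density 0 s (fst z - snd z)) * K z" for z
  proof -
    have "(LINT x|lborel. F x z) = (LINT x|lborel. (exp (\<i> * complex_of_real ((fst z - snd z) * x)) * w x) * K z)"
      unfolding F_def by (intro Bochner_Integration.integral_cong) (auto simp: algebra_simps)
    then show ?thesis
      using fourier_gaussian[OF s, of "fst z - snd z"]
      unfolding integral_mult_left_zero fourier_def w_def by simp
  qed
  ultimately show ?thesis unfolding w_def K_def by (simp only:)
qed

text \<open>The kernel has to be bounded only at pairs where both functions are nonzero; this is how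
  separation of the supports enters.\<close>

lemma cmod_gaussian_parseval_le:
  assumes "integrable lborel g" "integrable lborel h" and s: "0 < s"
    and C: "\<And>k k'. g k \<noteq> 0 \<Longrightarrow> h k' \<noteq> 0 \<Longrightarrow> normal_density 0 s (k - k') \<le> C"
  shows "cmod (LINT x|lborel. complex_of_real (exp (- (s * x)\<^sup>2 / 2)) * (fourier g x * cnj (fourier h x)))
     \<le> 2 * pi * C * ((LINT k|lborel. cmod (g k)) * (LINT k|lborel. cmod (h k)))"
proof -
  note [measurable] = borel_measurable_integrable[OF assms(1)] borel_measurable_integrable[OF assms(2)]
  have i: "integrable (lborel \<Otimes>\<^sub>M lborel) (\<lambda>z. cmod (g (fst z)) * cmod (h (snd z)))"
    using assms by (intro lborel_pair.integrable_mult_fst_snd integrable_norm)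
  have le: "cmod (complex_of_real (2 * pi * normal_density 0 s (k - k')) * (g k * cnj (h k')))
      \<le> 2 * pi * C * (cmod (g k) * cmod (h k'))" for k k'
  proof (cases "g k = 0 \<or> h k' = 0")
    case False
    then show ?thesis
      using C[of k k'] by (auto simp: norm_mult mult_right_mono)
  qed auto
  have "cmod (LINT x|lborel. complex_of_real (exp (- (s * x)\<^sup>2 / 2)) * (fourier g x * cnj (fourier h x)))
    \<le> (LINT z|(lborel \<Otimes>\<^sub>M lborel). 2 * pi * C * (cmod (g (fst z)) * cmod (h (snd z))))"
    unfolding gaussian_parseval[OF assms(1-3)]
    by (rule order_trans[OF integral_norm_bound], rule integral_mono_AE')
      (use i le order_trans[OF norm_ge_zero le] in \<open>auto simp del: of_real_mult intro!: integrable_mult_right\<close>)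
  then show ?thesis
    using lborel_pair.integral_mult_fst_snd[OF integrable_norm[OF assms(1)] integrable_norm[OF assms(2)]]
    by simp
qed

lemma gaussian_weight_tendsto: "(\<lambda>n. exp (- (1 / real (Suc n) * x)\<^sup>2 / 2)) \<longlonglongrightarrow> 1"
proof -
  have "(\<lambda>n. exp (- (1 / real (Suc n) * x)\<^sup>2 / 2)) \<longlonglongrightarrow> exp (- (0 * x)\<^sup>2 / 2)"
    by (intro tendsto_intros LIMSEQ_Suc[OF lim_1_over_n]) auto
  then show ?thesis by simp
qed

section \<open>Removing the weight: orthogonality and the Plancherel bound\<close>

text \<open>The weighted integrals have two limits. Dominated convergence gives the unweighted
  integral. On the supports the kernel is at most \<open>normal_density 0 s \<delta>\<close>, and
  this tends to 0 with \<open>s\<close> although the peak of the density grows like 1/s.\<close>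

lemma fourier_orthogonal:
  assumes g: "integrable lborel g" and h: "integrable lborel h"
    and gh: "integrable lborel (\<lambda>x. fourier g x * cnj (fourier h x))"
    and "0 < \<delta>" and sep: "\<And>k k'. g k \<noteq> 0 \<Longrightarrow> h k' \<noteq> 0 \<Longrightarrow> \<delta> \<le> \<bar>k - k'\<bar>"
  shows "(LINT x|lborel. fourier g x * cnj (fourier h x)) = 0"
proof -
  define s where "s n = 1 / real (Suc n)" for n
  define I where "I n = (LINT x|lborel. complex_of_real (exp (- (s n * x)\<^sup>2 / 2)) * (fourier g x * cnj (fourier h x)))" for n
  note [measurable] = borel_measurable_integrable[OF gh]
  have "I \<longlonglongrightarrow> (LINT x|lborel. fourier g x * cnj (fourier h x))"
    unfolding I_def
  proof (rule integral_dominated_convergence[where w = "\<lambda>x. cmod (fourier g x * cnj (fourier h x))"])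
    have "(\<lambda>n. complex_of_real (exp (- (s n * x)\<^sup>2 / 2)) * (fourier g x * cnj (fourier h x)))
        \<longlonglongrightarrow> complex_of_real 1 * (fourier g x * cnj (fourier h x))" for x
      unfolding s_def by (intro tendsto_intros gaussian_weight_tendsto)
    then show "AE x in lborel. (\<lambda>n. complex_of_real (exp (- (s n * x)\<^sup>2 / 2)) * (fourier g x * cnj (fourier h x)))
        \<longlonglongrightarrow> fourier g x * cnj (fourier h x)" by simp
  qed (use integrable_norm[OF gh] in \<open>auto simp: norm_mult mult_left_le_one_le\<close>)
  moreover have "I \<longlonglongrightarrow> 0"
  proof (rule Lim_null_comparison)
    have "normal_density 0 (s n) (k - k') \<le> normal_density 0 (s n) \<delta>" if "g k \<noteq> 0" "h k' \<noteq> 0" for n k k'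
    proof -
      have "\<delta>\<^sup>2 \<le> (k - k')\<^sup>2" using power_mono[OF sep[OF that], of 2] \<open>0 < \<delta>\<close> by simp
      then show ?thesis
        by (auto simp: normal_density_def intro!: divide_right_mono)
    qed
    then show "\<forall>\<^sub>F n in sequentially. norm (I n) \<le> 2 * pi * normal_density 0 (s n) \<delta> *
        ((LINT k|lborel. cmod (g k)) * (LINT k|lborel. cmod (h k)))"
      unfolding I_def by (intro always_eventually allI cmod_gaussian_parseval_le g h) (auto simp: s_def)
    have "(\<lambda>n. normal_density 0 (s n) \<delta>) \<longlonglongrightarrow> 0"
      using \<open>0 < \<delta>\<close> unfolding normal_density_def s_def by real_asymp
    then have "(\<lambda>n. 2 * pi * normal_density 0 (s n) \<delta> * ((LINT k|lborel. cmod (g k)) * (LINT k|lborel. cmod (h k))))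
        \<longlonglongrightarrow> 2 * pi * 0 * ((LINT k|lborel. cmod (g k)) * (LINT k|lborel. cmod (h k)))"
      by (intro tendsto_intros)
    then show "(\<lambda>n. 2 * pi * normal_density 0 (s n) \<delta> * ((LINT k|lborel. cmod (g k)) * (LINT k|lborel. cmod (h k))))
        \<longlonglongrightarrow> 0" by simp
  qed
  ultimately show ?thesis by (rule LIMSEQ_unique)
qed

lemma cmod_mult_cnj_le: "cmod (a * cnj b) \<le> ((cmod a)\<^sup>2 + (cmod b)\<^sup>2) / 2"
  using sum_squares_bound[of "cmod a" "cmod b"] by (simp add: norm_mult)

text \<open>A Schur test for the Gaussian kernel with \<open>h = g\<close>: the product of the two
  values of \<open>g\<close> is bounded by the mean of their squares, and the kernel has mass 2 pi
  in each variable. The resulting bound is uniform in \<open>s\<close>.\<close>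

lemma gaussian_fourier_le:
  assumes g: "integrable lborel g" and g2: "integrable lborel (\<lambda>k. (cmod (g k))\<^sup>2)" and s: "0 < s"
  shows "(\<integral>\<^sup>+x. ennreal (exp (- (s * x)\<^sup>2 / 2) * (cmod (fourier g x))\<^sup>2) \<partial>lborel)
    \<le> ennreal (2 * pi * (LINT k|lborel. (cmod (g k))\<^sup>2))"
proof -
  define w where "w x = exp (- (s * x)\<^sup>2 / 2)" for x
  define N where "N = normal_density 0 s"
  define B where "B = (LINT k|lborel. cmod (g k))"
  define f where "f k = (cmod (g k))\<^sup>2" for k
  have [measurable]: "g \<in> borel_measurable lborel" "N \<in> borel_measurable borel"
    using g by (auto simp: N_def)
  then have [measurable]: "f \<in> borel_measurable lborel"
    unfolding f_def by measurable
  have N0: "N x \<ge> 0" for x by (simp add: N_def)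
  \<comment> \<open>The crude bound by the L^1 norm serves only to make the weighted integrand
    integrable.\<close>
  have bound: "cmod (fourier g x) \<le> B" for x
  proof -
    have "cmod (fourier g x) \<le> (LINT k|lborel. cmod (exp (\<i> * complex_of_real (x * k)) * g k))"
      unfolding fourier_def by (rule integral_norm_bound)
    then show ?thesis by (simp add: norm_mult B_def)
  qed
  have w: "integrable lborel (\<lambda>x. w x * (cmod (fourier g x))\<^sup>2)"
  proof (rule Bochner_Integration.integrable_bound[OF integrable_mult_left[OF gaussian_integrable[OF s], of "B\<^sup>2"]])
    show "AE x in lborel. norm (w x * (cmod (fourier g x))\<^sup>2) \<le> norm (exp (- (s * x)\<^sup>2 / 2) * B\<^sup>2)"
      using bound by (auto simp: w_def intro!: power_mono)
  qed (simp add: w_def)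
  have Nint: "integrable lborel (\<lambda>k'. N (k - k'))" "(LINT k'|lborel. N (k - k')) = 1" for k
    using lborel_integrable_real_affine[of N "-1" k] lborel_integral_real_affine[of "-1" N k] s
    by (simp_all add: N_def)
  have f1: "integrable (lborel \<Otimes>\<^sub>M lborel) (\<lambda>z. f (fst z) * N (fst z - snd z))"
    by (rule lborel_pair.Fubini_integrable)
      (use g2 Nint in \<open>auto simp: f_def abs_mult N0\<close>)
  have f1I: "(LINT z|(lborel \<Otimes>\<^sub>M lborel). f (fst z) * N (fst z - snd z)) = (LINT k|lborel. f k)"
    using lborel_pair.integral_fst'[OF f1] Nint by simp
  have Nsym: "N (x - y) = N (y - x)" for x y
    by (simp add: N_def normal_density_def power2_commute)
  \<comment> \<open>\<open>N\<close> is even, so exchanging the two variables carries integrability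
    and value of the first term over to the second.\<close>
  have swap: "(\<lambda>(x, y). f (fst (y, x)) * N (fst (y, x) - snd (y, x))) = (\<lambda>z. f (snd z) * N (fst z - snd z))"
    by (auto simp: fun_eq_iff Nsym)
  have f2: "integrable (lborel \<Otimes>\<^sub>M lborel) (\<lambda>z. f (snd z) * N (fst z - snd z))"
    using lborel_pair.integrable_product_swap[OF f1] unfolding swap .
  have f2I: "(LINT z|(lborel \<Otimes>\<^sub>M lborel). f (snd z) * N (fst z - snd z)) = (LINT k|lborel. f k)"
    using lborel_pair.integral_product_swap[OF borel_measurable_integrable[OF f1]] f1I unfolding swap by simp
  have "complex_of_real (LINT x|lborel. w x * (cmod (fourier g x))\<^sup>2)
      = (LINT x|lborel. complex_of_real (w x) * (fourier g x * cnj (fourier g x)))"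
    by (simp only: complex_norm_square[symmetric] of_real_mult[symmetric] integral_complex_of_real)
  then have "(LINT x|lborel. w x * (cmod (fourier g x))\<^sup>2)
      \<le> cmod (LINT x|lborel. complex_of_real (w x) * (fourier g x * cnj (fourier g x)))"
    by (metis abs_ge_self norm_of_real)
  also have "\<dots> = cmod (LINT z|(lborel \<Otimes>\<^sub>M lborel).
      complex_of_real (2 * pi * N (fst z - snd z)) * (g (fst z) * cnj (g (snd z))))"
    using gaussian_parseval[OF g g s] by (simp add: w_def N_def)
  also have "\<dots> \<le> (LINT z|(lborel \<Otimes>\<^sub>M lborel).
      pi * (f (fst z) * N (fst z - snd z) + f (snd z) * N (fst z - snd z)))"
  proof (rule order_trans[OF integral_norm_bound], rule integral_mono_AE')
    have "cmod (complex_of_real (2 * pi * N t) * (g k * cnj (g k'))) \<le> pi * (f k * N t + f k' * N t)" for t k k'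
    proof -
      have "cmod (complex_of_real (2 * pi * N t) * (g k * cnj (g k')))
          = 2 * pi * N t * cmod (g k * cnj (g k'))"
        by (simp add: norm_mult N0)
      also have "\<dots> \<le> 2 * pi * N t * ((f k + f k') / 2)"
        unfolding f_def by (intro mult_left_mono cmod_mult_cnj_le) (simp add: N0)
      finally show ?thesis by (simp add: algebra_simps)
    qed
    then show "AE z in lborel \<Otimes>\<^sub>M lborel.
       cmod (complex_of_real (2 * pi * N (fst z - snd z)) * (g (fst z) * cnj (g (snd z))))
       \<le> pi * (f (fst z) * N (fst z - snd z) + f (snd z) * N (fst z - snd z))"
      by blast
  qed (use f1 f2 N0 in \<open>auto simp: f_def\<close>)
  also have "\<dots> = 2 * pi * (LINT k|lborel. f k)"
    using f1 f2 f1I f2I by simp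
  finally show ?thesis
    using w by (subst nn_integral_eq_integral) (auto simp: w_def f_def intro!: ennreal_leI)
qed

text \<open>Fatou's lemma replaces dominated convergence here, because integrability of the squared
  transform is not known beforehand but follows from this bound.\<close>

lemma fourier_nn_integral_le:
  assumes g: "integrable lborel g" and g2: "integrable lborel (\<lambda>k. (cmod (g k))\<^sup>2)"
  shows "(\<integral>\<^sup>+x. ennreal ((cmod (fourier g x))\<^sup>2) \<partial>lborel)
    \<le> ennreal (2 * pi * (LINT k|lborel. (cmod (g k))\<^sup>2))"
proof -
  define s where "s n = 1 / real (Suc n)" for n
  have [measurable]: "g \<in> borel_measurable borel" using g by auto
  have "(\<lambda>n. exp (- (s n * x)\<^sup>2 / 2) * (cmod (fourier g x))\<^sup>2) \<longlonglongrightarrow> 1 * (cmod (fourier g x))\<^sup>2" for x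
    unfolding s_def by (intro tendsto_intros gaussian_weight_tendsto)
  then have "liminf (\<lambda>n. ennreal (exp (- (s n * x)\<^sup>2 / 2) * (cmod (fourier g x))\<^sup>2))
      = ennreal ((cmod (fourier g x))\<^sup>2)" for x
    by (intro lim_imp_Liminf tendsto_ennrealI) auto
  then have "(\<integral>\<^sup>+x. ennreal ((cmod (fourier g x))\<^sup>2) \<partial>lborel)
      = (\<integral>\<^sup>+x. liminf (\<lambda>n. ennreal (exp (- (s n * x)\<^sup>2 / 2) * (cmod (fourier g x))\<^sup>2)) \<partial>lborel)"
    by simp
  also have "\<dots> \<le> liminf (\<lambda>n. \<integral>\<^sup>+x. ennreal (exp (- (s n * x)\<^sup>2 / 2) * (cmod (fourier g x))\<^sup>2) \<partial>lborel)"
    by (rule nn_integral_liminf) simp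
  also have "\<dots> \<le> ennreal (2 * pi * (LINT k|lborel. (cmod (g k))\<^sup>2))"
    using gaussian_fourier_le[OF g g2, of "s _"]
    by (intro order_trans[OF Liminf_le_Limsup] Limsup_bounded always_eventually allI) (auto simp: s_def)
  finally show ?thesis .
qed

lemma fourier_L2:
  assumes g: "integrable lborel g" and g2: "integrable lborel (\<lambda>k. (cmod (g k))\<^sup>2)"
  shows fourier_L2_fun: "fourier g \<in> L2_fun lborel"
    and fourier_integral_le: "(LINT x|lborel. (cmod (fourier g x))\<^sup>2) \<le> 2 * pi * (LINT k|lborel. (cmod (g k))\<^sup>2)"
proof -
  have [measurable]: "g \<in> borel_measurable borel" using g by auto
  note le = fourier_nn_integral_le[OF g g2]
  have i: "integrable lborel (\<lambda>x. (cmod (fourier g x))\<^sup>2)"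
    by (rule integrableI_bounded) (use le in \<open>auto simp: le_less_trans\<close>)
  then show "fourier g \<in> L2_fun lborel" by (simp add: L2_fun_def)
  show "(LINT x|lborel. (cmod (fourier g x))\<^sup>2) \<le> 2 * pi * (LINT k|lborel. (cmod (g k))\<^sup>2)"
    using le by (subst (asm) nn_integral_eq_integral[OF i]) (auto simp: ennreal_le_iff)
qed

subsection \<open>Completeness of the Hilbert space\<close>

lemma rep_L2R_L2_fun [simp]: "rep_L2R u \<in> L2_fun lborel"
  using Quotient_rep_reflp[OF Quotient_L2R, of u] by (simp add: L2_eq_def)

lemma rep_L2R_measurable [measurable]: "rep_L2R u \<in> borel_measurable borel"
  using L2_fun_measurable[OF rep_L2R_L2_fun, of u] by simp

lemma abs_rep_L2R [simp]: "abs_L2R (rep_L2R u) = u"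
  by (rule Quotient_abs_rep[OF Quotient_L2R])

lemma abs_L2R_eqI:
  "f \<in> L2_fun lborel \<Longrightarrow> g \<in> L2_fun lborel \<Longrightarrow> AE x in lborel. f x = g x \<Longrightarrow> abs_L2R f = abs_L2R g"
  by (rule Quotient_rel_abs[OF Quotient_L2R]) (simp add: L2_eq_def)

lemma L2_fun_diff: "f \<in> L2_fun M \<Longrightarrow> g \<in> L2_fun M \<Longrightarrow> (\<lambda>x. f x - g x) \<in> L2_fun M"
  using L2_fun_add[of f M "\<lambda>x. (-1) * g x"] L2_fun_cmult[of g M "-1"] by simp

lemma abs_L2R_diff:
  assumes "f \<in> L2_fun lborel" "g \<in> L2_fun lborel"
  shows "abs_L2R f - abs_L2R g = abs_L2R (\<lambda>x. f x - g x)"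
proof -
  have "(\<lambda>x. - g x) \<in> L2_fun lborel" using L2_fun_cmult[OF assms(2), of "-1"] by simp
  then show ?thesis
    using assms by (simp add: minus_L2R_def uminus_L2R.abs_eq plus_L2R.abs_eq L2_eq_def)
qed

lemma norm_abs_L2R:
  assumes "f \<in> L2_fun lborel"
  shows "(norm (abs_L2R f))\<^sup>2 = (LINT x|lborel. (cmod (f x))\<^sup>2)"
proof -
  have "complex_of_real ((norm (abs_L2R f))\<^sup>2) = (LINT x|lborel. cnj (f x) * f x)"
    using cinner_abs[OF assms assms] by (simp only: cinner_self)
  also have "\<dots> = (LINT x|lborel. complex_of_real ((cmod (f x))\<^sup>2))"
    by (simp only: complex_norm_square mult.commute)
  finally show ?thesis unfolding integral_complex_of_real of_real_eq_iff .
qed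

lemma nn_integral_abs_L2R:
  assumes "f \<in> L2_fun lborel"
  shows "(\<integral>\<^sup>+x. ennreal ((cmod (f x))\<^sup>2) \<partial>lborel) = ennreal ((norm (abs_L2R f))\<^sup>2)"
  using assms by (simp add: norm_abs_L2R nn_integral_eq_integral L2_fun_def)

lemma Cauchy_fast_subseq:
  fixes X :: "nat \<Rightarrow> 'a::real_normed_vector"
  assumes "Cauchy X" and e: "\<And>n. 0 < e n"
  obtains r :: "nat \<Rightarrow> nat" where "strict_mono r" "\<And>n m. n \<le> m \<Longrightarrow> norm (X (r m) - X (r n)) < e n"
proof -
  have "\<exists>M. \<forall>m\<ge>M. \<forall>k\<ge>M. norm (X m - X k) < e n" for n
    using CauchyD[OF assms(1) e] .
  then obtain M where M: "\<And>n m k. m \<ge> M n \<Longrightarrow> k \<ge> M n \<Longrightarrow> norm (X m - X k) < e n" by metis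
  \<comment> \<open>The summand \<open>n\<close> makes \<open>r\<close> strictly increasing; the sum
    dominates every earlier \<open>M i\<close> even if \<open>M\<close> is not monotone.\<close>
  define r where "r n = n + (\<Sum>i\<le>n. M i)" for n
  have r: "strict_mono r" by (simp add: strict_mono_Suc_iff r_def)
  have ge: "r m \<ge> M n" if "n \<le> m" for n m
    using member_le_sum[of n "{..m}" M] that by (simp add: r_def)
  show ?thesis by (rule that[OF r]) (simp add: M ge)
qed

text \<open>On a space of infinite measure the L^2 norms of the increments do not control their L^1
  norms. The squares weighted by \<open>2^n\<close> still have a finite integral, with terms
  (2/16)^n, and their pointwise summability forces absolute summability of the increments.\<close>

lemma fast_L2_Cauchy_AE_convergent:
  fixes f :: "nat \<Rightarrow> 'a \<Rightarrow> complex"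
  assumes [measurable]: "\<And>n. f n \<in> borel_measurable M"
    and le: "\<And>n. (\<integral>\<^sup>+x. ennreal ((cmod (f (Suc n) x - f n x))\<^sup>2) \<partial>M) \<le> ennreal ((1/16)^n)"
  shows "AE x in M. convergent (\<lambda>n. f n x)"
proof -
  define d where "d n x = f (Suc n) x - f n x" for n x
  have [measurable]: "d n \<in> borel_measurable M" for n unfolding d_def by measurable
  have "(\<integral>\<^sup>+x. (\<Sum>n. ennreal (2^n * (cmod (d n x))\<^sup>2)) \<partial>M)
      = (\<Sum>n. (\<integral>\<^sup>+x. ennreal (2^n * (cmod (d n x))\<^sup>2) \<partial>M))"
    by (rule nn_integral_suminf) simp
  also have "\<dots> \<le> (\<Sum>n. ennreal ((1/8)^n))"
  proof (rule suminf_le)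
    fix n
    have "(\<integral>\<^sup>+x. ennreal (2^n * (cmod (d n x))\<^sup>2) \<partial>M)
        = ennreal (2^n) * (\<integral>\<^sup>+x. ennreal ((cmod (d n x))\<^sup>2) \<partial>M)"
      by (subst nn_integral_cmult[symmetric]) (auto simp: ennreal_mult)
    also have "\<dots> \<le> ennreal (2^n) * ennreal ((1/16)^n)"
      using le by (intro mult_left_mono) (auto simp: d_def)
    also have "\<dots> = ennreal ((1/8)^n)"
      by (simp add: ennreal_mult[symmetric] power_mult_distrib[symmetric])
    finally show "(\<integral>\<^sup>+x. ennreal (2^n * (cmod (d n x))\<^sup>2) \<partial>M) \<le> ennreal ((1/8)^n)" .
  qed auto
  also have "\<dots> = ennreal (\<Sum>n. (1/8)^n)"
    by (intro suminf_ennreal2) (auto intro: summable_geometric)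
  also have "\<dots> < \<infinity>" by simp
  finally have "AE x in M. (\<Sum>n. ennreal (2^n * (cmod (d n x))\<^sup>2)) \<noteq> \<infinity>"
    by (intro nn_integral_PInf_AE) auto
  then show ?thesis
  proof eventually_elim
    case (elim x)
    then have s: "summable (\<lambda>n. 2^n * (cmod (d n x))\<^sup>2)"
      by (intro summable_suminf_not_top) (auto simp: infinity_ennreal_def)
    have "summable (\<lambda>n. (1/2)^n + 2^n * (cmod (d n x))\<^sup>2)"
      by (intro summable_add s summable_geometric) simp
    moreover have "norm (d n x) \<le> (1/2)^n + 2^n * (cmod (d n x))\<^sup>2" for n
    proof -
      define c where "c = cmod (d n x)"
      \<comment> \<open>With a = (1/2)^n, the inequality c <= a + c^2/a is c^2 - c a + a^2 >= 0
        divided by a.\<close>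
      have "0 \<le> 2^n * ((c - (1/2)^n)\<^sup>2 + c * (1/2)^n)" by (simp add: c_def)
      also have "\<dots> = 2^n * c\<^sup>2 - (2^n * (1/2)^n) * c + (2^n * (1/2)^n) * (1/2)^n"
        by (simp only: power2_eq_square) algebra
      also have "(2::real)^n * (1/2)^n = 1" by (simp add: power_mult_distrib[symmetric])
      finally show ?thesis by (simp add: c_def)
    qed
    ultimately have "summable (\<lambda>n. d n x)"
      by (rule summable_comparison_test'[where N = 0])
    moreover have "(\<lambda>n. \<Sum>i<n. d i x) = (\<lambda>n. f n x - f 0 x)"
      unfolding d_def by (rule ext, rule sum_lessThan_telescope)
    ultimately have "convergent (\<lambda>n. f n x - f 0 x)"
      by (simp only: summable_iff_convergent)
    from convergent_add[OF this convergent_const[of "f 0 x"]] show ?case by simp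
  qed
qed

text \<open>The Riesz-Fischer argument: a fast subsequence converges almost everywhere, and Fatou's
  lemma turns its Cauchy estimate into a rate of convergence to the pointwise limit.\<close>

instance L2R :: complete_space
proof
  fix X :: "nat \<Rightarrow> L2R" assume X: "Cauchy X"
  define e :: "nat \<Rightarrow> real" where "e n = (1/4)^n" for n
  obtain r where r: "strict_mono r" and le: "\<And>n m. n \<le> m \<Longrightarrow> norm (X (r m) - X (r n)) < e n"
    using Cauchy_fast_subseq[OF X, of e] by (auto simp: e_def)
  define f where "f n = rep_L2R (X (r n))" for n
  have f: "f n \<in> L2_fun lborel" and absf: "abs_L2R (f n) = X (r n)" for n by (auto simp: f_def)
  have [measurable]: "f n \<in> borel_measurable lborel" for n by (rule L2_fun_measurable[OF f])
  have diff: "(\<integral>\<^sup>+x. ennreal ((cmod (f m x - f n x))\<^sup>2) \<partial>lborel) \<le> ennreal ((e n)\<^sup>2)" if "n \<le> m" for n m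
    using le[OF that]
    by (simp add: nn_integral_abs_L2R L2_fun_diff f abs_L2R_diff[symmetric] absf power_mono)
  have "(e n)\<^sup>2 = (1/16)^n" for n
    by (simp add: e_def power2_eq_square power_mult_distrib[symmetric])
  then have conv: "AE x in lborel. convergent (\<lambda>n. f n x)"
    using diff[of _ "Suc _"] by (intro fast_L2_Cauchy_AE_convergent) auto
  \<comment> \<open>Where the subsequence diverges \<open>lim\<close> takes some unspecified value,
    but this concerns only a null set.\<close>
  define F where "F x = lim (\<lambda>n. f n x)" for x
  have [measurable]: "F \<in> borel_measurable lborel" unfolding F_def by measurable
  have Fd: "(\<integral>\<^sup>+x. ennreal ((cmod (F x - f n x))\<^sup>2) \<partial>lborel) \<le> ennreal ((e n)\<^sup>2)" for n
  proof -
    have "(\<integral>\<^sup>+x. ennreal ((cmod (F x - f n x))\<^sup>2) \<partial>lborel)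
        = (\<integral>\<^sup>+x. liminf (\<lambda>m. ennreal ((cmod (f m x - f n x))\<^sup>2)) \<partial>lborel)"
    proof (rule nn_integral_cong_AE, use conv in eventually_elim)
      case (elim x)
      then have "(\<lambda>m. f m x) \<longlonglongrightarrow> F x" unfolding F_def by (simp add: convergent_LIMSEQ_iff)
      then have "(\<lambda>m. ennreal ((cmod (f m x - f n x))\<^sup>2)) \<longlonglongrightarrow> ennreal ((cmod (F x - f n x))\<^sup>2)"
        by (intro tendsto_ennrealI tendsto_intros)
      then show ?case by (rule lim_imp_Liminf[OF trivial_limit_sequentially, symmetric])
    qed
    also have "\<dots> \<le> liminf (\<lambda>m. \<integral>\<^sup>+x. ennreal ((cmod (f m x - f n x))\<^sup>2) \<partial>lborel)"
      by (rule nn_integral_liminf) simp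
    also have "\<dots> \<le> ennreal ((e n)\<^sup>2)"
      by (rule order_trans[OF Liminf_le_Limsup], simp, rule Limsup_bounded,
          rule eventually_mono[OF eventually_ge_at_top[of n]], rule diff)
    finally show ?thesis .
  qed
  have Ff: "(\<lambda>x. F x - f n x) \<in> L2_fun lborel" for n
    unfolding L2_fun_def using Fd[of n]
    by (auto intro!: integrableI_bounded simp: le_less_trans[OF _ ennreal_less_top])
  have F: "F \<in> L2_fun lborel" using L2_fun_add[OF Ff[of 0] f[of 0]] by simp
  have "norm (X (r n) - abs_L2R F) \<le> e n" for n
  proof -
    have "ennreal ((norm (abs_L2R F - X (r n)))\<^sup>2) \<le> ennreal ((e n)\<^sup>2)"
      using Fd[of n] by (simp add: nn_integral_abs_L2R Ff abs_L2R_diff[symmetric] absf F f)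
    then show ?thesis
      by (simp add: e_def norm_minus_commute)
  qed
  then have "\<forall>\<^sub>F n in sequentially. norm ((X \<circ> r) n - abs_L2R F) \<le> e n" by simp
  moreover have "e \<longlonglongrightarrow> 0" unfolding e_def by (rule LIMSEQ_power_zero) simp
  ultimately have "(\<lambda>n. (X \<circ> r) n - abs_L2R F) \<longlonglongrightarrow> 0"
    by (rule Lim_null_comparison)
  then have "(X \<circ> r) \<longlonglongrightarrow> abs_L2R F"
    by (rule Lim_null[THEN iffD2])
  then show "convergent X"
    using Cauchy_converges_subseq[OF X r] by (auto simp: convergent_def o_def)
qed

instance L2R :: banach ..

section \<open>Norm estimates for the complex inner product\<close>

lemma norm_scaleC: "norm (scaleC c u) = cmod c * norm u"
proof -
  have "complex_of_real ((norm (scaleC c u))\<^sup>2) = (c * cnj c) * complex_of_real ((norm u)\<^sup>2)"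
    by (simp only: cinner_self[symmetric] cinner_scaleC_left cinner_scaleC_right) (simp add: algebra_simps)
  also have "\<dots> = complex_of_real ((cmod c * norm u)\<^sup>2)"
    by (simp only: complex_norm_square[symmetric] of_real_mult power_mult_distrib)
  finally have "(norm (scaleC c u))\<^sup>2 = (cmod c * norm u)\<^sup>2"
    unfolding of_real_eq_iff .
  then show ?thesis by (simp add: power2_eq_iff_nonneg)
qed

text \<open>The real Cauchy-Schwarz inequality sees only the real part of \<open>cinner\<close>, so
  a phase \<open>c\<close> first rotates the value onto the nonnegative half-line.\<close>

lemma cmod_cinner_le: "cmod (cinner u v) \<le> norm u * norm v"
proof -
  obtain c where c: "cmod c = 1" "c * cinner u v = cmod (cinner u v)"
  proof (cases "cinner u v = 0")
    case False
    define z where "z = cinner u v"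
    have "cnj z * z = complex_of_real (cmod z) * complex_of_real (cmod z)"
      by (simp only: mult.commute[of _ z] complex_norm_square[symmetric] of_real_mult[symmetric] power2_eq_square)
    with False show ?thesis
      by (intro that[of "cnj z / complex_of_real (cmod z)"]) (auto simp: z_def[symmetric] norm_divide)
  qed (auto intro: that[of 1])
  have "cmod (cinner u v) = Re (cinner u (scaleC c v))"
    by (simp add: cinner_scaleC_right c)
  also have "\<dots> \<le> norm u * norm (scaleC c v)"
    unfolding inner_L2R_def[symmetric] by (rule norm_cauchy_schwarz)
  finally show ?thesis by (simp add: norm_scaleC c)
qed

lemma bounded_linear_cinner_right: "bounded_linear (cinner u)"
  using cmod_cinner_le[of u]
  by (intro bounded_linear_intro[of _ "norm u"])
    (auto simp: cinner_add_right scaleR_L2R_def cinner_scaleC_right scaleR_conv_of_real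
      mult.commute[of _ "norm u"])

subsection \<open>The support of the momentum wave function\<close>

text \<open>\<open>fourier\<close> is meaningful for integrable functions; a cutoff to a set of
  finite measure provides integrability through t <= 1 + t^2.\<close>

lemma L2_fun_integrable_indicator:
  assumes f: "f \<in> L2_fun M" and A: "A \<in> sets M" "emeasure M A < \<infinity>"
  shows "integrable M (\<lambda>x. indicator A x * f x)"
    and "(\<lambda>x. indicator A x * f x) \<in> L2_fun M"
proof -
  have [measurable]: "f \<in> borel_measurable M" "A \<in> sets M" using f A by (auto simp: L2_fun_def)
  show "integrable M (\<lambda>x. indicator A x * f x)"
  proof (rule Bochner_Integration.integrable_bound)
    show "integrable M (\<lambda>x. indicator A x + (cmod (f x))\<^sup>2)"
      using f A by (auto simp: L2_fun_def)
    have "t \<le> 1 + t\<^sup>2" for t :: real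
      using zero_le_power2[of "t - 1 / 2"] by (simp add: power2_eq_square algebra_simps)
    then show "AE x in M. norm (indicator A x * f x) \<le> norm (indicator A x + (cmod (f x))\<^sup>2)"
      by (auto simp: indicator_def)
  qed measurable
  show "(\<lambda>x. indicator A x * f x) \<in> L2_fun M"
    by (rule L2_fun_bounded_mult[OF f, of _ 1]) (auto simp: indicator_def)
qed

lemma L2_funD: "f \<in> L2_fun M \<Longrightarrow> integrable M (\<lambda>x. (cmod (f x))\<^sup>2)"
  by (simp add: L2_fun_def)

text \<open>Extension by zero makes the spectral function live on the whole line, with its support
  condition valid at every point. It is integrable because the band has finite length.\<close>

lemma momentum_limitedE:
  assumes "momentum_limited \<kappa> \<psi>"
  obtains g where "integrable lborel g" "g \<in> L2_fun lborel" "\<And>k. g k \<noteq> 0 \<Longrightarrow> \<bar>k\<bar> < \<kappa>"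
    "AE x in lborel. rep_L2R \<psi> x = fourier g x"
proof -
  let ?I = "{- \<kappa><..<\<kappa>}"
  obtain g where g: "g \<in> L2_fun (restrict_space lborel ?I)"
    and eq: "AE x in lborel. rep_L2R \<psi> x =
          (LINT k|restrict_space lborel ?I. exp (\<i> * complex_of_real (x * k)) * g k)"
    using assms by (auto simp: momentum_limited_def)
  define g0 where "g0 k = indicator ?I k * g k" for k
  have "integrable lborel (\<lambda>k. indicator ?I k *\<^sub>R (cmod (g k))\<^sup>2)"
    using g by (simp add: L2_fun_def integrable_restrict_space)
  also have "(\<lambda>k. indicator ?I k *\<^sub>R (cmod (g k))\<^sup>2) = (\<lambda>k. (cmod (g0 k))\<^sup>2)"
    by (auto simp: g0_def indicator_def)
  finally have "integrable lborel (\<lambda>k. (cmod (g0 k))\<^sup>2)" .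
  moreover have "g0 = (\<lambda>k. indicator ?I k *\<^sub>R g k)"
    by (auto simp: g0_def indicator_def)
  then have "g0 \<in> borel_measurable lborel"
    using g borel_measurable_restrict_space_iff[of ?I lborel g] by (simp add: L2_fun_def)
  ultimately have g0: "g0 \<in> L2_fun lborel" by (simp add: L2_fun_def)
  have "g0 = (\<lambda>k. indicator ?I k * g0 k)" by (auto simp: g0_def indicator_def)
  moreover have "integrable lborel (\<lambda>k. indicator ?I k * g0 k)"
    using assms by (intro L2_fun_integrable_indicator g0) (auto simp: momentum_limited_def)
  ultimately have "integrable lborel g0" by simp
  moreover have "(LINT k|restrict_space lborel ?I. exp (\<i> * complex_of_real (x * k)) * g k) = fourier g0 x" for x
    unfolding fourier_def by (subst integral_restrict_space)
      (auto simp: g0_def indicator_def intro!: Bochner_Integration.integral_cong)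
  moreover have "g0 k \<noteq> 0 \<Longrightarrow> \<bar>k\<bar> < \<kappa>" for k by (auto simp: g0_def indicator_def split: if_splits)
  ultimately show ?thesis using that[of g0] g0 eq by simp
qed

lemma abs_L2R_indicator_tendsto:
  "(\<lambda>n. abs_L2R (\<lambda>q. indicator {- real n..real n} q * rep_L2R Psi q)) \<longlonglongrightarrow> Psi"
proof -
  define f where "f = rep_L2R Psi"
  have f: "f \<in> L2_fun lborel" and absf: "abs_L2R f = Psi" by (auto simp: f_def)
  have [measurable]: "f \<in> borel_measurable borel" by (simp add: f_def)
  define g where "g n q = indicator {- real n..real n} q * f q" for n q
  have g: "g n \<in> L2_fun lborel" for n
    unfolding g_def by (rule L2_fun_integrable_indicator[OF f]) auto
  have "(\<lambda>n. LINT q|lborel. (cmod (g n q - f q))\<^sup>2) \<longlonglongrightarrow> (LINT q|(lborel :: real measure). 0)"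
  proof (rule integral_dominated_convergence[where w = "\<lambda>q. (cmod (f q))\<^sup>2"])
    show "AE q in lborel. (\<lambda>n. (cmod (g n q - f q))\<^sup>2) \<longlonglongrightarrow> 0"
    proof (rule AE_I2, rule tendsto_eventually)
      fix q :: real
      obtain n where "\<bar>q\<bar> \<le> real n" using real_arch_simple by blast
      then show "\<forall>\<^sub>F n in sequentially. (cmod (g n q - f q))\<^sup>2 = 0"
        by (intro eventually_mono[OF eventually_ge_at_top[of n]]) (auto simp: g_def indicator_def)
    qed
    show "AE q in lborel. norm ((cmod (g n q - f q))\<^sup>2) \<le> (cmod (f q))\<^sup>2" for n
      by (auto simp: g_def indicator_def)
  qed (use L2_funD[OF f] in \<open>auto simp: g_def\<close>)
  then have "(\<lambda>n. (norm (abs_L2R (g n) - Psi))\<^sup>2) \<longlonglongrightarrow> 0"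
    by (simp add: absf[symmetric] abs_L2R_diff g f norm_abs_L2R L2_fun_diff)
  then have "(\<lambda>n. sqrt ((norm (abs_L2R (g n) - Psi))\<^sup>2)) \<longlonglongrightarrow> sqrt 0"
    by (rule tendsto_real_sqrt)
  then have "(\<lambda>n. abs_L2R (g n)) \<longlonglongrightarrow> Psi"
    by (simp add: tendsto_norm_zero_iff flip: Lim_null)
  then show ?thesis by (simp add: g_def[abs_def] f_def)
qed

section \<open>The momentum transform as a limit of truncated integrals\<close>

definition momentum_fourier :: "real \<Rightarrow> (real \<Rightarrow> complex) \<Rightarrow> real \<Rightarrow> complex" where
  "momentum_fourier hbar f p = complex_of_real (1 / sqrt (2 * pi * hbar)) * fourier f (- p / hbar)"

text \<open>The normalising factor cancels both the 2 pi of \<open>fourier_integral_le\<close> and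
  the \<open>hbar\<close> produced by rescaling the argument. What remains is a contraction.\<close>

lemma momentum_fourier_L2:
  assumes hbar: "0 < hbar" and f: "integrable lborel f" "f \<in> L2_fun lborel"
  shows momentum_fourier_L2_fun: "momentum_fourier hbar f \<in> L2_fun lborel"
    and norm_momentum_fourier_le: "norm (abs_L2R (momentum_fourier hbar f)) \<le> norm (abs_L2R f)"
proof -
  define F where "F x = (cmod (fourier f x))\<^sup>2" for x
  note L2 = fourier_L2[OF f(1) L2_funD[OF f(2)]]
  have [measurable]: "f \<in> borel_measurable borel" using f(1) by simp
  have F: "integrable lborel F" using L2(1) by (auto simp: L2_fun_def F_def[abs_def])
  have eq: "(cmod (momentum_fourier hbar f p))\<^sup>2 = 1 / (2 * pi * hbar) * F (0 + (- 1 / hbar) * p)" for p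
    using hbar by (simp add: momentum_fourier_def F_def norm_mult norm_divide power_mult_distrib power_divide real_sqrt_mult)
  have i: "integrable lborel (\<lambda>p. F (0 + (- 1 / hbar) * p))"
    using hbar by (intro lborel_integrable_real_affine F) auto
  show mem: "momentum_fourier hbar f \<in> L2_fun lborel"
  proof -
    have "integrable lborel (\<lambda>p. (cmod (momentum_fourier hbar f p))\<^sup>2)"
      unfolding eq by (rule integrable_mult_right[OF i])
    then show ?thesis by (simp add: L2_fun_def momentum_fourier_def[abs_def])
  qed
  have "(norm (abs_L2R (momentum_fourier hbar f)))\<^sup>2
      = 1 / (2 * pi * hbar) * (LINT p|lborel. F (0 + (- 1 / hbar) * p))"
    unfolding norm_abs_L2R[OF mem] eq by (rule integral_mult_right_zero)
  also have "(LINT p|lborel. F (0 + (- 1 / hbar) * p)) = hbar * (LINT x|lborel. F x)"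
    using lborel_integral_real_affine[of "- 1 / hbar" F 0] hbar by simp
  also have "1 / (2 * pi * hbar) * (hbar * (LINT x|lborel. F x)) = (LINT x|lborel. F x) / (2 * pi)"
    using hbar by simp
  also have "\<dots> \<le> (norm (abs_L2R f))\<^sup>2"
    using L2(2) by (simp add: F_def norm_abs_L2R f(2) pos_divide_le_eq mult.commute)
  finally show "norm (abs_L2R (momentum_fourier hbar f)) \<le> norm (abs_L2R f)"
    by (rule power2_le_imp_le) simp
qed

lemma fourier_diff:
  assumes "integrable lborel f" "integrable lborel g"
  shows "fourier (\<lambda>k. f k - g k) x = fourier f x - fourier g x"
  unfolding fourier_def right_diff_distrib
  by (intro Bochner_Integration.integral_diff fourier_integrand_integrable assms)

lemma momentum_trunc_eq:
  "momentum_trunc hbar Psi n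
    = abs_L2R (momentum_fourier hbar (\<lambda>q. indicator {- real n..real n} q * rep_L2R Psi q))"
proof -
  have "(LINT q:{- real n..real n}|lborel. exp (- (\<i> * complex_of_real (p * q / hbar))) * rep_L2R Psi q)
    = fourier (\<lambda>q. indicator {- real n..real n} q * rep_L2R Psi q) (- p / hbar)" for p
    unfolding fourier_def set_lebesgue_integral_def
    by (intro Bochner_Integration.integral_cong) (auto simp: indicator_def)
  then show ?thesis
    by (simp add: momentum_trunc_def momentum_fourier_def[abs_def])
qed

text \<open>This makes the \<open>lim\<close> in \<open>momentum_wf\<close> a genuine limit.
  Differences of truncations are transforms of differences, so the contraction property passes the
  Cauchy condition on from the cutoffs of \<open>Psi\<close>.\<close>

lemma momentum_trunc_convergent:
  assumes "0 < hbar"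
  shows "convergent (momentum_trunc hbar Psi)"
proof -
  define g where "g n q = indicator {- real n..real n} q * rep_L2R Psi q" for n q
  have g: "integrable lborel (g n)" "g n \<in> L2_fun lborel" for n
    unfolding g_def by (auto intro!: L2_fun_integrable_indicator)
  have le: "norm (momentum_trunc hbar Psi m - momentum_trunc hbar Psi n) \<le> norm (abs_L2R (g m) - abs_L2R (g n))" for m n
  proof -
    have "momentum_trunc hbar Psi m - momentum_trunc hbar Psi n
        = abs_L2R (\<lambda>p. momentum_fourier hbar (g m) p - momentum_fourier hbar (g n) p)"
      unfolding momentum_trunc_eq g_def[symmetric]
      by (intro abs_L2R_diff momentum_fourier_L2_fun assms g)
    also have "(\<lambda>p. momentum_fourier hbar (g m) p - momentum_fourier hbar (g n) p)
        = momentum_fourier hbar (\<lambda>q. g m q - g n q)"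
      by (simp add: fun_eq_iff momentum_fourier_def fourier_diff g right_diff_distrib)
    finally show ?thesis
      using norm_momentum_fourier_le[OF assms, of "\<lambda>q. g m q - g n q"] g
      by (simp add: abs_L2R_diff L2_fun_diff)
  qed
  have "Cauchy (\<lambda>n. abs_L2R (g n))"
    unfolding g_def by (rule LIMSEQ_imp_Cauchy[OF abs_L2R_indicator_tendsto])
  then have "Cauchy (momentum_trunc hbar Psi)"
    unfolding Cauchy_iff using le by (meson le_less_trans)
  then show ?thesis by (rule Cauchy_convergent)
qed

section \<open>Duality and vanishing outside the band\<close>

lemma fourier_scale:
  assumes "0 < c"
  shows "fourier f (x / c) = fourier (\<lambda>k. complex_of_real c * f (c * k)) x"
proof -
  have "fourier f (x / c) = \<bar>c\<bar> *\<^sub>R (LINT k|lborel. exp (\<i> * complex_of_real (x / c * (0 + c * k))) * f (0 + c * k))"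
    unfolding fourier_def using assms by (intro lborel_integral_real_affine) auto
  also have "\<dots> = fourier (\<lambda>k. complex_of_real c * f (c * k)) x"
    unfolding fourier_def integral_scaleR_right[symmetric]
    using assms by (intro Bochner_Integration.integral_cong) (auto simp: scaleR_conv_of_real)
  finally show ?thesis .
qed

text \<open>The multiplication formula: Fubini moves the transform from the position cutoff
  \<open>f\<close>, whose spectrum is not under control, to the test function \<open>h\<close>,
  whose support is.\<close>

lemma fourier_multiplication:
  assumes f: "integrable lborel f" and h: "integrable lborel h"
  shows "(LINT p|lborel. cnj (h p) * fourier f (- p / c)) = (LINT q|lborel. f q * cnj (fourier h (q / c)))"
proof -
  have [measurable]: "f \<in> borel_measurable lborel" "h \<in> borel_measurable lborel" using f h by auto
  define F where "F p q = cnj (h p) * f q * exp (\<i> * complex_of_real (- p / c * q))" for p q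
  have "integrable (lborel \<Otimes>\<^sub>M lborel) (case_prod F)"
  proof (rule Bochner_Integration.integrable_bound)
    show "integrable (lborel \<Otimes>\<^sub>M lborel) (\<lambda>z. cnj (h (fst z)) * f (snd z))"
      using f h by (intro lborel_pair.integrable_mult_fst_snd) auto
    show "case_prod F \<in> borel_measurable (lborel \<Otimes>\<^sub>M lborel)" unfolding F_def by measurable
  qed (auto simp: F_def norm_mult norm_exp_i_times simp del: of_real_mult of_real_divide of_real_minus)
  from lborel_pair.Fubini_integral[OF this]
  have "(LINT p|lborel. LINT q|lborel. F p q) = (LINT q|lborel. LINT p|lborel. F p q)" by simp
  moreover have "(LINT q|lborel. F p q) = cnj (h p) * fourier f (- p / c)" for p
    unfolding F_def fourier_def integral_mult_right_zero[symmetric]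
    by (intro Bochner_Integration.integral_cong) (auto simp: algebra_simps)
  moreover have "(LINT p|lborel. F p q) = f q * cnj (fourier h (q / c))" for q
    unfolding F_def fourier_def integral_mult_right_zero[symmetric] Bochner_Integration.integral_cnj[symmetric]
    by (intro Bochner_Integration.integral_cong) (auto simp: exp_cnj algebra_simps)
  ultimately show ?thesis by simp
qed

text \<open>Once the transform sits on \<open>h\<close>, the position cutoffs can be removed by
  continuity of the inner product. What remains pairs the transforms of \<open>g\<close> and of the
  rescaled \<open>h\<close>, whose supports are at distance at least
  \<open>\<delta>\<close>.\<close>

lemma momentum_wf_orthogonal:
  assumes hbar: "0 < hbar" and Psi: "momentum_limited \<kappa> Psi" and "0 < \<delta>"
    and h: "integrable lborel h" "h \<in> L2_fun lborel"
    and supp: "\<And>p. h p \<noteq> 0 \<Longrightarrow> hbar * (\<kappa> + \<delta>) \<le> \<bar>p\<bar>"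
  shows "(LINT p|lborel. cnj (h p) * momentum_wf hbar Psi p) = 0"
proof -
  obtain g where g: "integrable lborel g" "g \<in> L2_fun lborel" "\<And>k. g k \<noteq> 0 \<Longrightarrow> \<bar>k\<bar> < \<kappa>"
    and Psi_eq: "AE x in lborel. rep_L2R Psi x = fourier g x"
    using momentum_limitedE[OF Psi] by blast
  define f where "f n q = indicator {- real n..real n} q * rep_L2R Psi q" for n q
  have f: "integrable lborel (f n)" "f n \<in> L2_fun lborel" for n
    unfolding f_def by (auto intro!: L2_fun_integrable_indicator)
  \<comment> \<open>\<open>k\<close> is \<open>h\<close> expressed in the wave number p/hbar, with
    the Jacobian \<open>hbar\<close>; its \<open>fourier\<close> transform at q is that of
    \<open>h\<close> at \<open>q / hbar\<close>.\<close>
  define k where "k p = complex_of_real hbar * h (hbar * p)" for p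
  have k: "integrable lborel k"
    unfolding k_def using lborel_integrable_real_affine[OF h(1), of hbar 0] hbar by simp
  have "integrable lborel (\<lambda>p. (cmod (k p))\<^sup>2)"
    unfolding k_def using lborel_integrable_real_affine[OF L2_funD[OF h(2)], of hbar 0] hbar
    by (simp add: norm_mult power_mult_distrib)
  note kL2 = fourier_L2_fun[OF k this] and gL2 = fourier_L2_fun[OF g(1) L2_funD[OF g(2)]]
  define c where "c = complex_of_real (1 / sqrt (2 * pi * hbar))"
  have "cinner (abs_L2R h) (momentum_trunc hbar Psi n) = c * cinner (abs_L2R (fourier k)) (abs_L2R (f n))" for n
  proof -
    have "cinner (abs_L2R h) (momentum_trunc hbar Psi n)
        = (LINT p|lborel. c * (cnj (h p) * fourier (f n) (- p / hbar)))"
      unfolding momentum_trunc_eq f_def[symmetric]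
      by (subst cinner_abs[OF h(2) momentum_fourier_L2_fun[OF hbar f]])
        (simp add: momentum_fourier_def c_def mult.left_commute)
    also have "\<dots> = c * (LINT q|lborel. f n q * cnj (fourier k q))"
      unfolding integral_mult_right_zero fourier_multiplication[OF f(1) h(1)] fourier_scale[OF hbar, of h] k_def ..
    also have "\<dots> = c * cinner (abs_L2R (fourier k)) (abs_L2R (f n))"
      by (simp add: cinner_abs[OF kL2 f(2)] mult.commute)
    finally show ?thesis .
  qed
  moreover have "(\<lambda>n. cinner (abs_L2R h) (momentum_trunc hbar Psi n)) \<longlonglongrightarrow> cinner (abs_L2R h) (lim (momentum_trunc hbar Psi))"
    using momentum_trunc_convergent[OF hbar]
    by (intro bounded_linear.tendsto[OF bounded_linear_cinner_right]) (simp add: convergent_LIMSEQ_iff)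
  moreover have "(\<lambda>n. c * cinner (abs_L2R (fourier k)) (abs_L2R (f n))) \<longlonglongrightarrow> c * cinner (abs_L2R (fourier k)) Psi"
    unfolding f_def
    by (intro tendsto_intros bounded_linear.tendsto[OF bounded_linear_cinner_right] abs_L2R_indicator_tendsto)
  ultimately have "cinner (abs_L2R h) (lim (momentum_trunc hbar Psi)) = c * cinner (abs_L2R (fourier k)) Psi"
    using LIMSEQ_unique by auto
  also have "cinner (abs_L2R (fourier k)) Psi = cinner (abs_L2R (fourier k)) (abs_L2R (fourier g))"
    using abs_L2R_eqI[OF rep_L2R_L2_fun gL2 Psi_eq] by simp
  also have "\<dots> = (LINT x|lborel. fourier g x * cnj (fourier k x))"
    by (simp add: cinner_abs[OF kL2 gL2] mult.commute)
  also have "\<dots> = 0"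
  proof (rule fourier_orthogonal[OF g(1) k _ \<open>0 < \<delta>\<close>])
    show "integrable lborel (\<lambda>x. fourier g x * cnj (fourier k x))"
      using L2_fun_mult_integrable[OF kL2 gL2] by (simp add: mult.commute)
    fix x y assume "g x \<noteq> 0" "k y \<noteq> 0"
    then have "\<bar>x\<bar> < \<kappa>" "hbar * (\<kappa> + \<delta>) \<le> hbar * \<bar>y\<bar>"
      using g(3) supp[of "hbar * y"] hbar by (auto simp: k_def abs_mult)
    then show "\<delta> \<le> \<bar>x - y\<bar>" using hbar by simp
  qed
  finally have "cinner (abs_L2R h) (lim (momentum_trunc hbar Psi)) = 0" by simp
  then show ?thesis
    using cinner_abs[OF h(2) rep_L2R_L2_fun, of "lim (momentum_trunc hbar Psi)"]
    by (simp add: momentum_wf_def)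
qed

lemma momentum_wf_L2_fun: "momentum_wf hbar Psi \<in> L2_fun lborel"
  by (simp add: momentum_wf_def)

text \<open>The sets \<open>A n\<close> exhaust the exterior of the band. They are bounded, so that
  cutting off to \<open>A n\<close> gives an integrable test function, and they stay away from the
  band, as orthogonality requires. Testing the wave function against its own restriction to
  \<open>A n\<close> shows that this restriction has norm zero.\<close>

lemma momentum_wf_eq_0:
  assumes hbar: "0 < hbar" and Psi: "momentum_limited \<kappa> Psi"
  shows "AE p in lborel. hbar * \<kappa> < \<bar>p\<bar> \<longrightarrow> momentum_wf hbar Psi p = 0"
proof -
  define X where "X = momentum_wf hbar Psi"
  define A where "A n = {p. hbar * (\<kappa> + 1 / real (Suc n)) \<le> \<bar>p\<bar>} \<inter> {- real n..real n}" for n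
  have [measurable]: "X \<in> borel_measurable borel" by (simp add: X_def momentum_wf_def)
  have A [measurable]: "A n \<in> sets lborel" for n unfolding A_def by measurable
  have Afin: "emeasure lborel (A n) < \<infinity>" for n
    by (rule le_less_trans[OF emeasure_mono[of _ "{- real n..real n}"]]) (auto simp: A_def)
  have "AE p in lborel. indicator (A n) p * X p = 0" for n
  proof -
    define h where "h p = indicator (A n) p * X p" for p
    have h: "integrable lborel h" "h \<in> L2_fun lborel"
      unfolding h_def X_def by (intro L2_fun_integrable_indicator momentum_wf_L2_fun A Afin)+
    have "complex_of_real (LINT p|lborel. (cmod (h p))\<^sup>2) = (LINT p|lborel. cnj (h p) * X p)"
      unfolding integral_complex_of_real[symmetric] complex_norm_square
      by (intro Bochner_Integration.integral_cong) (auto simp: h_def indicator_def)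
    also have "\<dots> = 0"
      unfolding X_def
      by (rule momentum_wf_orthogonal[OF hbar Psi _ h, of "1 / real (Suc n)"])
        (auto simp: h_def A_def indicator_def split: if_splits)
    finally have "(LINT p|lborel. (cmod (h p))\<^sup>2) = 0" by simp
    then have "AE p in lborel. (cmod (h p))\<^sup>2 = 0"
      by (subst (asm) integral_nonneg_eq_0_iff_AE) (use L2_funD[OF h(2)] in auto)
    then show ?thesis by (simp add: h_def)
  qed
  then have "AE p in lborel. \<forall>n. indicator (A n) p * X p = 0"
    unfolding AE_all_countable by blast
  then show ?thesis
  proof eventually_elim
    case (elim p)
    show ?case
    proof
      assume p: "hbar * \<kappa> < \<bar>p\<bar>"
      have "(\<lambda>n. hbar * (\<kappa> + 1 / real (Suc n))) \<longlonglongrightarrow> hbar * (\<kappa> + 0)"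
        by (intro tendsto_intros LIMSEQ_Suc[OF lim_1_over_n])
      then have "\<forall>\<^sub>F n in sequentially. hbar * (\<kappa> + 1 / real (Suc n)) < \<bar>p\<bar>"
        using p by (intro order_tendstoD(2)) auto
      moreover have "\<forall>\<^sub>F n in sequentially. \<bar>p\<bar> \<le> real n"
        using eventually_ge_at_top[of "nat \<lceil>\<bar>p\<bar>\<rceil>"] by eventually_elim linarith
      ultimately have "\<forall>\<^sub>F n in sequentially. p \<in> A n"
        by eventually_elim (auto simp: A_def)
      then obtain n where "p \<in> A n"
        using eventually_happens'[OF trivial_limit_sequentially] by blast
      then show "momentum_wf hbar Psi p = 0"
        using elim[rule_format, of n] by (simp add: X_def)
    qed
  qed
qed

subsection \<open>The pointer states\<close>

lemma exp_iB_L2_fun: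
  "f \<in> L2_fun lborel \<Longrightarrow> (\<lambda>b. exp (\<i> * complex_of_real (t * b)) * f b) \<in> L2_fun lborel"
  by (rule L2_fun_bounded_mult[where C = 1]) auto

lemma exp_iB_eq: "exp_iB t u = abs_L2R (\<lambda>b. exp (\<i> * complex_of_real (t * b)) * rep_L2R u b)"
  by (simp add: exp_iB_def fun_of_B_def)

lemma fourier_shift:
  "fourier (\<lambda>k. g (k - t)) b = exp (\<i> * complex_of_real (t * b)) * fourier g b"
proof -
  have "fourier (\<lambda>k. g (k - t)) b = (LINT k|lborel. exp (\<i> * complex_of_real (b * (t + 1 * k))) * g (t + 1 * k - t))"
    unfolding fourier_def using lborel_integral_real_affine[of 1 "\<lambda>k. exp (\<i> * complex_of_real (b * k)) * g (k - t)" t]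
    by simp
  then show ?thesis
    unfolding fourier_def integral_mult_right_zero[symmetric]
    by (simp add: algebra_simps exp_add)
qed

text \<open>The two spectral functions are shifted into open intervals of half-width
  \<open>b0\<close> around \<open>s\<close> and \<open>t\<close>; the gap
  \<open>\<bar>s - t\<bar> - 2 * b0\<close> serves as \<delta> in
  \<open>fourier_orthogonal\<close>.\<close>

lemma exp_iB_orthogonal:
  assumes Phi: "momentum_limited b0 Phi" and "2 * b0 < \<bar>s - t\<bar>"
  shows "cinner (exp_iB s Phi) (exp_iB t Phi) = 0"
proof -
  obtain g where g: "integrable lborel g" "g \<in> L2_fun lborel" "\<And>k. g k \<noteq> 0 \<Longrightarrow> \<bar>k\<bar> < b0"
    and Phi_eq: "AE x in lborel. rep_L2R Phi x = fourier g x"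
    using momentum_limitedE[OF Phi] by blast
  define gs where "gs u k = g (k - u)" for u k
  have gs: "integrable lborel (gs u)" for u
    using lborel_integrable_real_affine[OF g(1), of 1 "- u"] by (simp add: gs_def[abs_def])
  have gs2: "integrable lborel (\<lambda>k. (cmod (gs u k))\<^sup>2)" for u
    using lborel_integrable_real_affine[OF L2_funD[OF g(2)], of 1 "- u"] by (simp add: gs_def)
  note L2 = fourier_L2_fun[OF gs gs2]
  have eq: "exp_iB u Phi = abs_L2R (fourier (gs u))" for u
    unfolding exp_iB_eq
  proof (rule abs_L2R_eqI[OF exp_iB_L2_fun L2])
    show "AE b in lborel. exp (\<i> * complex_of_real (u * b)) * rep_L2R Phi b = fourier (gs u) b"
      using Phi_eq by eventually_elim (simp add: gs_def[abs_def] fourier_shift)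
  qed simp
  have "cinner (exp_iB s Phi) (exp_iB t Phi) = (LINT x|lborel. fourier (gs t) x * cnj (fourier (gs s) x))"
    unfolding eq by (simp add: cinner_abs[OF L2 L2] mult.commute)
  also have "\<dots> = 0"
  proof (rule fourier_orthogonal[OF gs gs])
    show "integrable lborel (\<lambda>x. fourier (gs t) x * cnj (fourier (gs s) x))"
      using L2_fun_mult_integrable[OF L2[of s] L2[of t]] by (simp add: mult.commute)
    show "0 < \<bar>s - t\<bar> - 2 * b0" using assms by simp
    fix x y assume "gs t x \<noteq> 0" "gs s y \<noteq> 0"
    then have "\<bar>x - t\<bar> < b0" "\<bar>y - s\<bar> < b0" using g(3) by (auto simp: gs_def)
    then show "\<bar>s - t\<bar> - 2 * b0 \<le> \<bar>x - y\<bar>" by linarith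
  qed
  finally show ?thesis .
qed

lemma norm_exp_iB: "norm (exp_iB t u) = norm u"
proof -
  have "(norm (exp_iB t u))\<^sup>2 = (norm (abs_L2R (rep_L2R u)))\<^sup>2"
    unfolding exp_iB_eq norm_abs_L2R[OF rep_L2R_L2_fun] norm_abs_L2R[OF exp_iB_L2_fun[OF rep_L2R_L2_fun]]
    by (simp add: norm_mult del: of_real_mult)
  then show ?thesis by (simp add: power2_eq_iff_nonneg)
qed

text \<open>Continuity for each fixed vector is enough to make the rank-one operators in the pointer
  states continuous in trace norm, and this yields strong measurability of the integrand.\<close>

lemma continuous_on_exp_iB: "continuous_on UNIV (\<lambda>t. exp_iB t u)"
proof (rule continuous_on_sequentiallyI)
  fix s :: "nat \<Rightarrow> real" and t assume s: "s \<longlonglongrightarrow> t"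
  define f where "f = rep_L2R u"
  define e where "e t b = exp (\<i> * complex_of_real (t * b)) * f b" for t b
  have f: "f \<in> L2_fun lborel" and [measurable]: "f \<in> borel_measurable borel" by (simp_all add: f_def)
  have e: "e t \<in> L2_fun lborel" for t unfolding e_def by (rule exp_iB_L2_fun[OF f])
  have "(\<lambda>n. LINT b|lborel. (cmod (e (s n) b - e t b))\<^sup>2) \<longlonglongrightarrow> (LINT b|(lborel :: real measure). 0)"
  proof (rule integral_dominated_convergence[where w = "\<lambda>b. 4 * (cmod (f b))\<^sup>2"])
    have "(\<lambda>n. (cmod (e (s n) b - e t b))\<^sup>2) \<longlonglongrightarrow> (cmod (e t b - e t b))\<^sup>2" for b
      unfolding e_def by (intro tendsto_intros s)
    then show "AE b in lborel. (\<lambda>n. (cmod (e (s n) b - e t b))\<^sup>2) \<longlonglongrightarrow> 0" by simp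
    have "(cmod (e (s n) b - e t b))\<^sup>2 \<le> (2 * cmod (f b))\<^sup>2" for n b
      using norm_triangle_ineq4[of "e (s n) b" "e t b"]
      by (intro power_mono) (auto simp: e_def norm_mult simp del: of_real_mult)
    then show "AE b in lborel. norm ((cmod (e (s n) b - e t b))\<^sup>2) \<le> 4 * (cmod (f b))\<^sup>2" for n
      by (simp add: power_mult_distrib)
  qed (use L2_funD[OF f] in \<open>auto simp: e_def\<close>)
  moreover have "exp_iB t u = abs_L2R (e t)" for t
    by (simp add: exp_iB_eq f_def e_def[abs_def])
  ultimately have "(\<lambda>n. (norm (exp_iB (s n) u - exp_iB t u))\<^sup>2) \<longlonglongrightarrow> 0"
    by (simp add: abs_L2R_diff e norm_abs_L2R L2_fun_diff)
  then have "(\<lambda>n. sqrt ((norm (exp_iB (s n) u - exp_iB t u))\<^sup>2)) \<longlonglongrightarrow> sqrt 0"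
    by (rule tendsto_real_sqrt)
  then show "(\<lambda>n. exp_iB (s n) u) \<longlonglongrightarrow> exp_iB t u"
    by (simp add: tendsto_norm_zero_iff flip: Lim_null)
qed

subsection \<open>Completeness of the trace class\<close>

lemma Rep_trace_class_props:
  shows Rep_trace_class_add: "Rep_trace_class T (u + v) = Rep_trace_class T u + Rep_trace_class T v"
    and Rep_trace_class_scaleC: "Rep_trace_class T (scaleC c u) = scaleC c (Rep_trace_class T u)"
    and Rep_trace_class_bdd: "bdd_above (trace_sums (Rep_trace_class T))"
  using Rep_trace_class[of T] by (auto simp: clinear_op_def)

lemma Rep_trace_class_scaleR: "Rep_trace_class T (r *\<^sub>R u) = r *\<^sub>R Rep_trace_class T u"
  by (simp add: scaleR_L2R_def Rep_trace_class_scaleC)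

lemma Rep_trace_class_minus: "Rep_trace_class (S - T) u = Rep_trace_class S u - Rep_trace_class T u"
  unfolding minus_trace_class_def uminus_trace_class_def plus_trace_class.rep_eq scaleR_trace_class.rep_eq
  by simp

lemma trace_class_eqI:
  assumes "\<And>u v. cinner v (Rep_trace_class S u) = cinner v (Rep_trace_class T u)"
  shows "S = T"
proof -
  have "Rep_trace_class S u - Rep_trace_class T u = 0" for u
    using assms[of "Rep_trace_class S u - Rep_trace_class T u" u]
    by (subst cinner_self_eq_zero[symmetric]) (simp add: cinner_diff_right)
  then show ?thesis by (simp add: Rep_trace_class_inject[symmetric] fun_eq_iff)
qed

lemma trace_sum_le_norm:
  "orthonormal n e \<Longrightarrow> orthonormal n f \<Longrightarrow> (\<Sum>i<n. cmod (cinner (e i) (Rep_trace_class T (f i)))) \<le> norm T"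
  unfolding norm_trace_class.rep_eq by (rule trace_norm_upper[OF Rep_trace_class_bdd])

text \<open>Orthonormal systems of length one show that the trace norm dominates the operator
  norm.\<close>

lemma cmod_cinner_trace_class_le:
  "cmod (cinner v (Rep_trace_class T u)) \<le> norm T * (norm u * norm v)"
proof (cases "u = 0 \<or> v = 0")
  case True
  moreover have "Rep_trace_class T 0 = 0"
    using Rep_trace_class_scaleR[of T 0 0] by simp
  ultimately show ?thesis by auto
next
  case False
  have unit: "orthonormal 1 (\<lambda>_. w /\<^sub>R norm w)" if "w \<noteq> 0" for w
    using that by (simp add: orthonormal_def cinner_self)
  have "cmod (cinner (v /\<^sub>R norm v) (Rep_trace_class T (u /\<^sub>R norm u))) \<le> norm T"
    using trace_sum_le_norm[OF unit unit, of v u T] False by simp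
  moreover have "cinner (v /\<^sub>R norm v) (Rep_trace_class T (u /\<^sub>R norm u))
      = complex_of_real (1 / (norm u * norm v)) * cinner v (Rep_trace_class T u)"
    by (simp only: Rep_trace_class_scaleR)
      (simp add: scaleR_L2R_def cinner_scaleC_left cinner_scaleC_right divide_inverse)
  ultimately have "1 / (norm u * norm v) * cmod (cinner v (Rep_trace_class T u)) \<le> norm T"
    by (simp only: norm_mult norm_of_real) simp
  then show ?thesis using False by (simp add: pos_divide_le_eq)
qed

lemma norm_trace_class_apply_le: "norm (Rep_trace_class T u) \<le> norm T * norm u"
proof (cases "Rep_trace_class T u = 0")
  case False
  have "(norm (Rep_trace_class T u))\<^sup>2 \<le> (norm T * norm u) * norm (Rep_trace_class T u)"
    using cmod_cinner_trace_class_le[of "Rep_trace_class T u" T u]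
    by (simp add: cinner_self norm_power mult.assoc del: of_real_power)
  then show ?thesis using False by (simp add: power2_eq_square)
qed simp

lemma bounded_linear_scaleC: "bounded_linear (scaleC c)"
  by (rule bounded_linear_intro[of _ "cmod c"])
    (auto simp: scaleC_add_right scaleC_scaleR norm_scaleC)

text \<open>The trace norm dominates the operator norm, so a Cauchy sequence converges at every
  vector. Each finite sum in \<open>trace_sums\<close> is continuous under such limits, and bounds
  uniform over all orthonormal systems survive.\<close>

instance trace_class :: complete_space
proof
  fix X :: "nat \<Rightarrow> trace_class" assume X: "Cauchy X"
  define R where "R n = Rep_trace_class (X n)" for n
  have "Cauchy (\<lambda>n. R n u)" for u
  proof (rule CauchyI)
    fix e :: real assume e: "0 < e"
    obtain M where M: "\<And>m n. m \<ge> M \<Longrightarrow> n \<ge> M \<Longrightarrow> norm (X m - X n) < e / (norm u + 1)"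
      using CauchyD[OF X, of "e / (norm u + 1)"] e by (auto simp: add_nonneg_pos)
    have "norm (R m u - R n u) < e" if "m \<ge> M" "n \<ge> M" for m n
    proof -
      have "norm (R m u - R n u) \<le> norm (X m - X n) * norm u"
        unfolding R_def Rep_trace_class_minus[symmetric] by (rule norm_trace_class_apply_le)
      also have "\<dots> \<le> norm (X m - X n) * (norm u + 1)" by (intro mult_left_mono) auto
      also have "\<dots> < e" using M[OF that] by (simp add: pos_less_divide_eq add_nonneg_pos)
      finally show ?thesis .
    qed
    then show "\<exists>M. \<forall>m\<ge>M. \<forall>n\<ge>M. norm (R m u - R n u) < e" by blast
  qed
  then have "convergent (\<lambda>n. R n u)" for u by (rule Cauchy_convergent)
  then obtain T where T: "\<And>u. (\<lambda>n. R n u) \<longlonglongrightarrow> T u"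
    unfolding convergent_def by metis
  have "clinear_op T"
    unfolding clinear_op_def
  proof (intro conjI allI)
    fix u v c
    have "(\<lambda>n. R n (u + v)) \<longlonglongrightarrow> T u + T v"
      unfolding R_def Rep_trace_class_add unfolding R_def[symmetric] by (intro tendsto_add T)
    then show "T (u + v) = T u + T v" by (rule LIMSEQ_unique[OF T])
    have "(\<lambda>n. R n (scaleC c u)) \<longlonglongrightarrow> scaleC c (T u)"
      unfolding R_def Rep_trace_class_scaleC unfolding R_def[symmetric]
      by (rule bounded_linear.tendsto[OF bounded_linear_scaleC T])
    then show "T (scaleC c u) = scaleC c (T u)" by (rule LIMSEQ_unique[OF T])
  qed
  \<comment> \<open>This is used with \<open>S\<close> zero to see that the limit is of trace class,
    and with \<open>S = R n\<close> to see convergence in trace norm.\<close>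
  have lim_le: "(\<Sum>i<k. cmod (cinner (e i) (S (f i) - T (f i)))) \<le> C"
    if "\<And>m. m \<ge> M \<Longrightarrow> (\<Sum>i<k. cmod (cinner (e i) (S (f i) - R m (f i)))) \<le> C" for S C k e f M
  proof (rule LIMSEQ_le_const2)
    show "(\<lambda>m. \<Sum>i<k. cmod (cinner (e i) (S (f i) - R m (f i))))
        \<longlonglongrightarrow> (\<Sum>i<k. cmod (cinner (e i) (S (f i) - T (f i))))"
      by (intro tendsto_intros bounded_linear.tendsto[OF bounded_linear_cinner_right] T)
  qed (use that in blast)
  obtain K where K: "\<And>n. norm (X n) \<le> K"
    using Cauchy_Bseq[OF X] by (auto simp: Bseq_def)
  have "bdd_above (trace_sums T)"
  proof (rule trace_norm_least(1))
    fix n e f assume ef: "orthonormal n e" "orthonormal n f"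
    have "(\<Sum>i<n. cmod (cinner (e i) (0 - R m (f i)))) \<le> K" for m
      using order_trans[OF trace_sum_le_norm[OF ef] K] by (simp add: cinner_minus_right R_def)
    from lim_le[of 0 e "\<lambda>_. 0" f n, OF this]
    show "(\<Sum>i<n. cmod (cinner (e i) (T (f i)))) \<le> K"
      by (simp add: cinner_minus_right)
  qed
  with \<open>clinear_op T\<close> have Rep: "Rep_trace_class (Abs_trace_class T) = T"
    by (simp add: Abs_trace_class_inverse)
  have "X \<longlonglongrightarrow> Abs_trace_class T"
  proof (rule LIMSEQ_I)
    fix \<epsilon> :: real assume "0 < \<epsilon>"
    then obtain M where M: "\<And>m n. m \<ge> M \<Longrightarrow> n \<ge> M \<Longrightarrow> norm (X m - X n) < \<epsilon> / 2"
      using CauchyD[OF X, of "\<epsilon> / 2"] by auto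
    have "norm (X n - Abs_trace_class T) \<le> \<epsilon> / 2" if n: "n \<ge> M" for n
      unfolding norm_trace_class.rep_eq
    proof (rule trace_norm_least(2))
      fix k e f assume ef: "orthonormal k e" "orthonormal k f"
      have "(\<Sum>i<k. cmod (cinner (e i) (R n (f i) - R m (f i)))) \<le> \<epsilon> / 2" if "m \<ge> M" for m
        using trace_sum_le_norm[OF ef, of "X n - X m"] M[OF n that]
        by (simp add: Rep_trace_class_minus R_def)
      from lim_le[of M e "R n" f k, OF this]
      show "(\<Sum>i<k. cmod (cinner (e i) (Rep_trace_class (X n - Abs_trace_class T) (f i)))) \<le> \<epsilon> / 2"
        by (simp add: Rep_trace_class_minus Rep R_def)
    qed
    then show "\<exists>N. \<forall>n\<ge>N. norm (X n - Abs_trace_class T) < \<epsilon>"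
      using \<open>0 < \<epsilon>\<close> by (intro exI[of _ M] allI impI) (force intro: le_less_trans)
  qed
  then show "convergent X" by (auto simp: convergent_def)
qed

instance trace_class :: banach ..

text \<open>Cauchy-Schwarz combined with Bessel's inequality for each factor gives the product of
  the norms, the form that bilinear continuity requires.\<close>

lemma norm_ketbra_le: "norm (ketbra u v) \<le> norm u * norm v"
  unfolding norm_trace_class.rep_eq
proof (rule trace_norm_least(2))
  fix n e f assume ef: "orthonormal n e" "orthonormal n f"
  have eq: "cmod (cinner (e i) (Rep_trace_class (ketbra u v) (f i)))
      = cmod (cinner (e i) u) * cmod (cinner (f i) v)" for i
    by (subst (2) cinner_commute) (simp add: ketbra.rep_eq cinner_scaleC_right norm_mult)
  have "(\<Sum>i<n. cmod (cinner (e i) u) * cmod (cinner (f i) v))\<^sup>2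
      \<le> (\<Sum>i<n. (cmod (cinner (e i) u))\<^sup>2) * (\<Sum>i<n. (cmod (cinner (f i) v))\<^sup>2)"
    by (rule Cauchy_Schwarz_ineq_sum)
  also have "\<dots> \<le> (norm u)\<^sup>2 * (norm v)\<^sup>2"
    by (intro mult_mono bessel_inequality ef) (auto intro: sum_nonneg)
  finally show "(\<Sum>i<n. cmod (cinner (e i) (Rep_trace_class (ketbra u v) (f i)))) \<le> norm u * norm v"
    unfolding eq power_mult_distrib[symmetric] by (rule power2_le_imp_le) simp
qed

lemma bounded_bilinear_ketbra: "bounded_bilinear ketbra"
proof
  fix u u' v v' and r :: real
  show "ketbra (u + u') v = ketbra u v + ketbra u' v"
    by (rule trace_class_eqI)
      (simp add: plus_trace_class.rep_eq ketbra.rep_eq scaleC_add_right)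
  show "ketbra u (v + v') = ketbra u v + ketbra u v'"
    by (rule trace_class_eqI)
      (simp add: plus_trace_class.rep_eq ketbra.rep_eq cinner_add_left scaleC_add_left)
  show "ketbra (r *\<^sub>R u) v = r *\<^sub>R ketbra u v"
    by (rule trace_class_eqI)
      (simp add: scaleR_trace_class.rep_eq ketbra.rep_eq scaleC_scaleR)
  show "ketbra u (r *\<^sub>R v) = r *\<^sub>R ketbra u v"
    by (rule trace_class_eqI)
      (simp add: scaleR_trace_class.rep_eq ketbra.rep_eq scaleR_L2R_def cinner_scaleC_left
        cinner_scaleC_right)
  show "\<exists>K. \<forall>u v. norm (ketbra u v) \<le> norm u * norm v * K"
    by (intro exI[of _ 1]) (simp add: norm_ketbra_le)
qed

text \<open>Matrix elements determine the operator (\<open>trace_class_eqI\<close>); being bounded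
  and linear, they also commute with the Bochner integral.\<close>

lemma bounded_linear_matrix_element: "bounded_linear (\<lambda>T. cinner v (Rep_trace_class T u))"
  by (rule bounded_linear_intro[of _ "norm u * norm v"])
    (simp_all add: plus_trace_class.rep_eq cinner_add_right scaleR_trace_class.rep_eq scaleR_L2R_def
      cinner_scaleC_right scaleR_conv_of_real cmod_cinner_trace_class_le)

subsection \<open>Bochner integrals\<close>

lemma simple_bochner_integral_diff_le:
  fixes s t :: "'a \<Rightarrow> 'b::real_normed_vector"
  assumes s: "Bochner_Integration.simple_bochner_integrable M s"
    and t: "Bochner_Integration.simple_bochner_integrable M t"
  shows "ennreal (norm (Bochner_Integration.simple_bochner_integral M s
      - Bochner_Integration.simple_bochner_integral M t)) \<le> (\<integral>\<^sup>+x. norm (s x - t x) \<partial>M)"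
proof -
  have "norm (Bochner_Integration.simple_bochner_integral M s
      - Bochner_Integration.simple_bochner_integral M t)
    \<le> Bochner_Integration.simple_bochner_integral M (\<lambda>x. norm (s x - t x))"
    unfolding Bochner_Integration.simple_bochner_integral_diff[OF s t, symmetric]
    by (rule Bochner_Integration.simple_bochner_integral_norm_bound)
      (rule Bochner_Integration.simple_bochner_integrable_compose2[OF _ s t], simp)
  also have "ennreal (Bochner_Integration.simple_bochner_integral M (\<lambda>x. norm (s x - t x)))
      = (\<integral>\<^sup>+x. norm (s x - t x) \<partial>M)"
    by (rule Bochner_Integration.simple_bochner_integral_eq_nn_integral)
      (rule Bochner_Integration.simple_bochner_integrable_compose2[OF _ s t], simp_all)
  finally show ?thesis by (simp add: ennreal_leI)
qed

text \<open>The value space may be non-separable, so the simple approximants are built from those of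
  the two real functions: \<open>F i\<close> for \<open>m\<close>, \<open>G i\<close> for
  \<open>t\<close>. The function \<open>F i p *\<^sub>R K (G i p)\<close> takes finitely many
  values, and continuity of \<open>K\<close> carries the convergence through. Completeness then
  gives the limit of the integrals.\<close>

lemma has_bochner_int_scaleR_continuous:
  fixes K :: "real \<Rightarrow> 'b::banach"
  assumes m: "integrable M m" and t [measurable]: "t \<in> borel_measurable M"
    and K: "continuous_on UNIV K" and C: "\<And>x. norm (K x) \<le> C"
  obtains x where "has_bochner_int M (\<lambda>p. m p *\<^sub>R K (t p)) x"
proof -
  define f where "f p = m p *\<^sub>R K (t p)" for p
  have [measurable]: "m \<in> borel_measurable M" using m by simp
  have C0: "0 \<le> C" using order_trans[OF norm_ge_zero C] .
  obtain F where "\<forall>i. simple_function M (F i)" "\<forall>x\<in>space M. (\<lambda>i. F i x) \<longlonglongrightarrow> m x"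
    "\<forall>i. \<forall>x\<in>space M. dist (F i x) 0 \<le> 2 * dist (m x) 0"
    using borel_measurable_implies_sequence_metric[of m M 0] by auto
  then have F: "\<And>i. simple_function M (F i)" "\<And>x. x \<in> space M \<Longrightarrow> (\<lambda>i. F i x) \<longlonglongrightarrow> m x"
    "\<And>i x. x \<in> space M \<Longrightarrow> \<bar>F i x\<bar> \<le> 2 * \<bar>m x\<bar>"
    by auto
  obtain G where "\<forall>i. simple_function M (G i)" "\<forall>x\<in>space M. (\<lambda>i. G i x) \<longlonglongrightarrow> t x"
    using borel_measurable_implies_sequence_metric[of t M 0] by auto
  then have G: "\<And>i. simple_function M (G i)" "\<And>x. x \<in> space M \<Longrightarrow> (\<lambda>i. G i x) \<longlonglongrightarrow> t x"
    by auto
  have [measurable]: "F i \<in> borel_measurable M" "G i \<in> borel_measurable M" for i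
    using F(1) G(1) by (auto intro: borel_measurable_simple_function)
  define s where "s i p = F i p *\<^sub>R K (G i p)" for i p
  have s_le: "norm (s i p) \<le> C * (2 * \<bar>m p\<bar>)" if "p \<in> space M" for i p
    using mult_mono[OF F(3)[OF that, of i] C[of "G i p"]] C0 by (simp add: s_def mult.commute)
  have sf: "simple_function M (s i)" for i
    unfolding s_def by (rule simple_function_compose2[OF F(1) G(1)])
  have mfin: "(\<integral>\<^sup>+p. ennreal (c * \<bar>m p\<bar>) \<partial>M) < \<infinity>" if "0 \<le> c" for c
    using integrable_mult_right[OF integrable_abs[OF m], of c] that
    by (simp add: nn_integral_eq_integral)
  have s: "Bochner_Integration.simple_bochner_integrable M (s i)" for i
  proof (rule Bochner_Integration.simple_bochner_integrableI_bounded[OF sf])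
    have "(\<integral>\<^sup>+p. ennreal (norm (s i p)) \<partial>M) \<le> (\<integral>\<^sup>+p. ennreal ((C * 2) * \<bar>m p\<bar>) \<partial>M)"
      using s_le by (intro nn_integral_mono ennreal_leI) (simp add: mult.assoc)
    also have "\<dots> < \<infinity>" using C0 by (intro mfin) simp
    finally show "(\<integral>\<^sup>+p. ennreal (norm (s i p)) \<partial>M) < \<infinity>" .
  qed
  have lim: "(\<lambda>i. s i p) \<longlonglongrightarrow> f p" if "p \<in> space M" for p
    unfolding s_def f_def
    by (intro tendsto_scaleR F(2) that continuous_on_tendsto_compose[OF K] G(2)) auto
  define d where "d i p = norm (f p - s i p)" for i p
  \<comment> \<open>Measurability of a difference is problematic in a non-separable space; here its
    norm is a continuous function \<open>H\<close> of four measurable real functions.\<close>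
  have [measurable]: "d i \<in> borel_measurable M" for i
  proof -
    define H where "H z = norm (fst (fst z) *\<^sub>R K (snd (fst z)) - fst (snd z) *\<^sub>R K (snd (snd z)))"
      for z :: "(real \<times> real) \<times> (real \<times> real)"
    have "continuous_on UNIV H"
      unfolding H_def by (intro continuous_intros continuous_on_compose2[OF K]) auto
    then have "H \<in> borel_measurable borel" by (rule borel_measurable_continuous_onI)
    moreover have "(\<lambda>p. ((m p, t p), (F i p, G i p))) \<in> M \<rightarrow>\<^sub>M borel" by measurable
    ultimately have "(\<lambda>p. H ((m p, t p), (F i p, G i p))) \<in> borel_measurable M"
      by (rule measurable_compose[rotated])
    then show ?thesis by (simp add: H_def d_def[abs_def] f_def s_def)
  qed
  define D where "D i = (\<integral>\<^sup>+p. ennreal (d i p) \<partial>M)" for i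
  have "D \<longlonglongrightarrow> (\<integral>\<^sup>+p. 0 \<partial>M)"
    unfolding D_def
  proof (rule nn_integral_dominated_convergence[where w = "\<lambda>p. ennreal ((3 * C) * \<bar>m p\<bar>)"])
    \<comment> \<open>One \<open>C\<close> comes from \<open>f\<close> and two from
      \<open>s i\<close>, since the simple approximants satisfy only the bound by
      \<open>2 * \<bar>m p\<bar>\<close>.\<close>
    have "d i p \<le> (3 * C) * \<bar>m p\<bar>" if "p \<in> space M" for i p
    proof -
      have "norm (f p) \<le> C * \<bar>m p\<bar>"
        using mult_left_mono[OF C[of "t p"], of "\<bar>m p\<bar>"] by (simp add: f_def mult.commute)
      then show ?thesis
        using norm_triangle_ineq4[of "f p" "s i p"] s_le[OF that, of i] by (simp add: d_def)
    qed
    then show "AE p in M. ennreal (d i p) \<le> ennreal ((3 * C) * \<bar>m p\<bar>)" for i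
      by (intro AE_I2 ennreal_leI)
    have "(\<lambda>i. ennreal (d i p)) \<longlonglongrightarrow> ennreal (norm (f p - f p))" if "p \<in> space M" for p
      unfolding d_def using lim[OF that] by (intro tendsto_ennrealI tendsto_intros)
    then show "AE p in M. (\<lambda>i. ennreal (d i p)) \<longlonglongrightarrow> 0" by (intro AE_I2) simp
    show "(\<integral>\<^sup>+p. ennreal ((3 * C) * \<bar>m p\<bar>) \<partial>M) < \<infinity>" using C0 by (intro mfin) simp
  qed auto
  then have D: "D \<longlonglongrightarrow> 0" by simp
  define I where "I i = Bochner_Integration.simple_bochner_integral M (s i)" for i
  have I_le: "ennreal (norm (I i - I j)) \<le> D i + D j" for i j
  proof -
    have "ennreal (norm (I i - I j)) \<le> (\<integral>\<^sup>+p. norm (s i p - s j p) \<partial>M)"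
      unfolding I_def by (rule simple_bochner_integral_diff_le[OF s s])
    also have "\<dots> \<le> (\<integral>\<^sup>+p. ennreal (d i p) + ennreal (d j p) \<partial>M)"
    proof (rule nn_integral_mono)
      fix p
      have "norm (s i p - s j p) \<le> d i p + d j p"
        using norm_triangle_ineq4[of "f p - s j p" "f p - s i p"] by (simp add: d_def)
      then show "ennreal (norm (s i p - s j p)) \<le> ennreal (d i p) + ennreal (d j p)"
        by (simp add: d_def flip: ennreal_plus)
    qed
    also have "\<dots> = D i + D j" unfolding D_def by (rule nn_integral_add) auto
    finally show ?thesis .
  qed
  have "Cauchy I"
  proof (rule CauchyI)
    fix e :: real assume e: "0 < e"
    then have "\<forall>\<^sub>F i in sequentially. D i < ennreal (e / 2)"
      by (intro order_tendstoD(2)[OF D]) simp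
    then obtain N where N: "\<And>i. i \<ge> N \<Longrightarrow> D i < ennreal (e / 2)"
      by (auto simp: eventually_sequentially)
    have "norm (I i - I j) < e" if "i \<ge> N" "j \<ge> N" for i j
    proof -
      have "ennreal (norm (I i - I j)) < ennreal (e / 2) + ennreal (e / 2)"
        by (rule le_less_trans[OF I_le]) (intro add_strict_mono N that)
      also have "\<dots> = ennreal e" using e by (simp flip: ennreal_plus)
      finally show ?thesis by (simp add: ennreal_less_iff)
    qed
    then show "\<exists>N. \<forall>i\<ge>N. \<forall>j\<ge>N. norm (I i - I j) < e" by blast
  qed
  then obtain x where x: "I \<longlonglongrightarrow> x" using Cauchy_convergent convergent_def by blast
  show ?thesis
  proof (rule that[of x], unfold has_bochner_int_def, intro exI[of _ s] conjI allI s)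
    show "AE p in M. (\<lambda>i. s i p) \<longlonglongrightarrow> m p *\<^sub>R K (t p)"
      using lim by (simp add: f_def)
    show "(\<lambda>i. \<integral>\<^sup>+p. ennreal (norm (m p *\<^sub>R K (t p) - s i p)) \<partial>M) \<longlonglongrightarrow> 0"
      using D by (simp add: D_def[abs_def] d_def f_def)
    show "(\<lambda>i. Bochner_Integration.simple_bochner_integral M (s i)) \<longlonglongrightarrow> x"
      using x by (simp add: I_def[abs_def])
  qed
qed

lemma has_bochner_int_bounded_linear:
  fixes L :: "'b::real_normed_vector \<Rightarrow> 'c::{real_normed_vector, second_countable_topology}"
  assumes fx: "has_bochner_int M f x" and L: "bounded_linear L"
    and meas [measurable]: "(\<lambda>p. L (f p)) \<in> borel_measurable M"
  shows "has_bochner_integral M (\<lambda>p. L (f p)) (L x)"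
proof -
  interpret L: bounded_linear L by fact
  obtain B where B: "0 < B" "\<And>u. norm (L u) \<le> norm u * B" using L.pos_bounded by blast
  text \<open>We scale to a contraction first, because \<open>f\<close> need not be measurable and so constants
    cannot be pulled out of the integrals of \<open>norm (f t - s i t)\<close>.\<close>
  define L' where "L' u = (1 / B) *\<^sub>R L u" for u
  interpret L': bounded_linear L'
    unfolding L'_def[abs_def] by (intro bounded_linear_scaleR_right[THEN bounded_linear_compose] L)
  have contr: "norm (L' u) \<le> norm u" for u
    using B(2)[of u] B(1) by (simp add: L'_def pos_divide_le_eq)
  obtain s where s: "\<And>i. Bochner_Integration.simple_bochner_integrable M (s i)"
    and lim: "(\<lambda>i. \<integral>\<^sup>+ t. ennreal (norm (f t - s i t)) \<partial>M) \<longlonglongrightarrow> 0"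
    and int: "(\<lambda>i. Bochner_Integration.simple_bochner_integral M (s i)) \<longlonglongrightarrow> x"
    using fx by (auto simp: has_bochner_int_def)
  have "has_bochner_integral M (\<lambda>p. L' (f p)) (L' x)"
  proof (rule has_bochner_integral.intros)
    show "(\<lambda>p. L' (f p)) \<in> borel_measurable M" unfolding L'_def by measurable
    show "Bochner_Integration.simple_bochner_integrable M (\<lambda>p. L' (s i p))" for i
      by (rule Bochner_Integration.simple_bochner_integrable_compose2[where p = "\<lambda>u v. L' u", OF _ s s])
        (rule L'.zero)
    show "(\<lambda>i. \<integral>\<^sup>+ p. ennreal (norm (L' (f p) - L' (s i p))) \<partial>M) \<longlonglongrightarrow> 0"
      by (rule tendsto_sandwich[OF _ _ tendsto_const lim])
        (auto intro!: always_eventually nn_integral_mono ennreal_leI contr simp: L'.diff[symmetric])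
    show "(\<lambda>i. Bochner_Integration.simple_bochner_integral M (\<lambda>p. L' (s i p))) \<longlonglongrightarrow> L' x"
      unfolding Bochner_Integration.simple_bochner_integral_linear[OF L'.linear_axioms s]
      by (rule L'.tendsto[OF int])
  qed
  from has_bochner_integral_bounded_linear[OF bounded_linear_scaleR_right[of B] this]
  show ?thesis using B(1) by (simp add: L'_def)
qed

subsection \<open>Products of pointer states\<close>

text \<open>The definite description in \<open>bochner_int\<close> calls for existence and
  uniqueness. Uniqueness falls out of the computation: every Bochner integral of this integrand has
  the stated matrix elements, and these determine it.\<close>

lemma pointer_state_cinner:
  fixes Psi Phi :: L2R
  shows "cinner v (Rep_trace_class (pointer_state hbar lam \<beta> Psi Phi x) u)
    = (LINT p|lborel. (cmod (momentum_wf hbar Psi p))\<^sup>2 *\<^sub>R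
        (cinner v (exp_iB ((lam * x - \<beta> * p) / hbar) Phi) * cinner (exp_iB ((lam * x - \<beta> * p) / hbar) Phi) u))"
proof -
  define K where "K t = conj_ketbra t Phi Phi" for t
  define m where "m p = (cmod (momentum_wf hbar Psi p))\<^sup>2" for p
  define t where "t p = (lam * x - \<beta> * p) / hbar" for p
  have K: "continuous_on UNIV K"
    unfolding K_def conj_ketbra_eq
    by (intro bounded_bilinear.continuous_on[OF bounded_bilinear_ketbra] continuous_on_exp_iB)
  have Kle: "norm (K t) \<le> norm Phi * norm Phi" for t
    unfolding K_def conj_ketbra_eq using norm_ketbra_le[of "exp_iB t Phi" "exp_iB t Phi"]
    by (simp add: norm_exp_iB)
  have m: "integrable lborel m"
    unfolding m_def by (rule L2_funD[OF momentum_wf_L2_fun])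
  have t [measurable]: "t \<in> borel_measurable lborel" unfolding t_def[abs_def] by measurable
  have [measurable]: "m \<in> borel_measurable lborel" using m by simp
  let ?f = "\<lambda>p. m p *\<^sub>R K (t p)"
  have val: "cinner v (Rep_trace_class T u) = (LINT p|lborel. m p *\<^sub>R cinner v (Rep_trace_class (K (t p)) u))"
    if T: "has_bochner_int lborel ?f T" for T u v
  proof -
    interpret L: bounded_linear "\<lambda>T. cinner v (Rep_trace_class T u)" by (rule bounded_linear_matrix_element)
    have "(\<lambda>s. cinner v (Rep_trace_class (K s) u)) \<in> borel_measurable borel"
      by (rule borel_measurable_continuous_onI, rule L.continuous_on[OF K])
    then have "(\<lambda>p. cinner v (Rep_trace_class (K (t p)) u)) \<in> borel_measurable lborel"
      by measurable
    then have "(\<lambda>p. cinner v (Rep_trace_class (?f p) u)) \<in> borel_measurable lborel"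
      unfolding L.scaleR by measurable
    from has_bochner_int_bounded_linear[OF T bounded_linear_matrix_element this]
    show ?thesis unfolding L.scaleR by (rule has_bochner_integral_integral_eq[symmetric])
  qed
  obtain T where T: "has_bochner_int lborel ?f T"
    using has_bochner_int_scaleR_continuous[OF m t K Kle] by blast
  have "T' = T" if "has_bochner_int lborel ?f T'" for T'
    by (rule trace_class_eqI) (simp only: val[OF T] val[OF that])
  then have "bochner_int lborel ?f = T"
    unfolding bochner_int_def using T by (intro the_equality)
  then have "pointer_state hbar lam \<beta> Psi Phi x = T"
    by (simp add: pointer_state_def m_def K_def t_def)
  then show ?thesis
    using val[OF T, of v u]
    by (simp add: m_def K_def t_def conj_ketbra_eq ketbra.rep_eq cinner_scaleC_right mult.commute)
qed

text \<open>Inserting the matrix elements twice leaves iterated scalar integrals containing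
  \<open>cinner (U x p) (U y q)\<close>, weighted by \<open>m p\<close> and \<open>m q\<close>. For
  momenta in the band, \<open>p\<close> and \<open>q\<close> each move the shift by at most
  \<open>\<bar>\<beta>\<bar> * \<kappa>\<close>, which is why \<open>sep\<close> counts this amount
  twice, just as it counts \<open>b0\<close> twice.\<close>

lemma pointer_state_comp_eq_0:
  assumes hbar: "0 < hbar" and Psi: "momentum_limited \<kappa> Psi" and Phi: "momentum_limited b0 Phi"
    and sep: "2 * hbar * (b0 + \<bar>\<beta>\<bar> * \<kappa>) < \<bar>lam * x - lam * y\<bar>"
  shows "Rep_trace_class (pointer_state hbar lam \<beta> Psi Phi x) \<circ>
    Rep_trace_class (pointer_state hbar lam \<beta> Psi Phi y) = (\<lambda>_. 0)"
proof -
  define U where "U x p = exp_iB ((lam * x - \<beta> * p) / hbar) Phi" for x p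
  define m where "m p = (cmod (momentum_wf hbar Psi p))\<^sup>2" for p
  define \<rho> where "\<rho> x = Rep_trace_class (pointer_state hbar lam \<beta> Psi Phi x)" for x
  have \<rho>: "cinner v (\<rho> x u) = (LINT p|lborel. m p *\<^sub>R (cinner v (U x p) * cinner (U x p) u))" for x u v
    unfolding \<rho>_def m_def U_def by (rule pointer_state_cinner)
  have m0: "AE p in lborel. hbar * \<kappa> < \<bar>p\<bar> \<longrightarrow> m p = 0"
    using momentum_wf_eq_0[OF hbar Psi] by eventually_elim (simp add: m_def)
  have U0: "cinner (U x p) (U y q) = 0" if p: "\<bar>p\<bar> \<le> hbar * \<kappa>" and q: "\<bar>q\<bar> \<le> hbar * \<kappa>" for p q
    unfolding U_def
  proof (rule exp_iB_orthogonal[OF Phi])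
    have "\<bar>\<beta> * p\<bar> \<le> \<bar>\<beta>\<bar> * (hbar * \<kappa>)" "\<bar>\<beta> * q\<bar> \<le> \<bar>\<beta>\<bar> * (hbar * \<kappa>)"
      using p q by (simp_all add: abs_mult mult_left_mono)
    with sep have "2 * hbar * b0 < \<bar>(lam * x - \<beta> * p) - (lam * y - \<beta> * q)\<bar>"
      by (simp add: algebra_simps)
    then show "2 * b0 < \<bar>(lam * x - \<beta> * p) / hbar - (lam * y - \<beta> * q) / hbar\<bar>"
      using hbar by (simp add: diff_divide_distrib[symmetric] abs_divide pos_less_divide_eq mult_ac)
  qed
  have inner0: "cinner (U x p) (\<rho> y u) = 0" if p: "\<bar>p\<bar> \<le> hbar * \<kappa>" for p u
    unfolding \<rho>
  proof (rule integral_eq_zero_AE, use m0 in eventually_elim)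
    case (elim q)
    then show ?case using U0[OF p, of q] by (cases "\<bar>q\<bar> \<le> hbar * \<kappa>") auto
  qed
  have "cinner v (\<rho> x (\<rho> y u)) = 0" for u v
    unfolding \<rho>[of v x]
  proof (rule integral_eq_zero_AE, use m0 in eventually_elim)
    case (elim p)
    then show ?case using inner0[of p u] by (cases "\<bar>p\<bar> \<le> hbar * \<kappa>") auto
  qed
  then have "\<rho> x (\<rho> y u) = 0" for u
    by (subst cinner_self_eq_zero[symmetric]) simp
  then show ?thesis by (simp add: \<rho>_def fun_eq_iff)
qed

section \<open>Symmetry of the characteristic function and the thresholds\<close>

text \<open>The hypothesis concerns moduli, so that even and odd wave functions are treated
  alike.\<close>

lemma charF_minus:
  assumes "AE p in lborel. cmod (momentum_wf hbar Psi (- p)) = cmod (momentum_wf hbar Psi p)"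
  shows "charF hbar \<beta> Psi (- \<eta>) = charF hbar \<beta> Psi \<eta>"
proof -
  have [measurable]: "momentum_wf hbar Psi \<in> borel_measurable borel" by (simp add: momentum_wf_def)
  have "charF hbar \<beta> Psi (- \<eta>) = (LINT p|lborel. complex_of_real ((cmod (momentum_wf hbar Psi (- p)))\<^sup>2) *
        exp (- (\<i> * complex_of_real (\<beta> * p * \<eta> / hbar))))"
    unfolding charF_def by (subst lborel_integral_real_affine[of "-1" _ 0]) simp_all
  also have "\<dots> = charF hbar \<beta> Psi \<eta>"
    unfolding charF_def
    by (rule integral_cong_AE) (use assms in \<open>auto elim!: eventually_mono\<close>)
  finally show ?thesis .
qed

lemma cnj_charF: "cnj (charF hbar \<beta> Psi \<eta>) = charF hbar \<beta> Psi (- \<eta>)"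
  unfolding charF_def Bochner_Integration.integral_cnj[symmetric]
  by (simp add: exp_cnj)

text \<open>\<open>D\<close> must be shown finite and nonempty for \<open>Min\<close> to be a true
  minimum; whichever of the two values is larger, their distance belongs to
  \<open>D\<close>.\<close>

lemma Min_difference_le:
  fixes a :: "nat \<Rightarrow> real"
  assumes inj: "inj_on a {1..N}" and k: "k \<in> {1..N}" "l \<in> {1..N}" "k \<noteq> l"
  defines "D \<equiv> {a k - a l | k l. k \<in> {1..N} \<and> l \<in> {1..N} \<and> a k > a l}"
  shows "0 < Min D" "Min D \<le> \<bar>a k - a l\<bar>"
proof -
  have "finite ((\<lambda>(k, l). a k - a l) ` ({1..N} \<times> {1..N}))" by simp
  then have fin: "finite D" by (rule finite_subset[rotated]) (auto simp: D_def)
  have "a k \<noteq> a l" using inj k by (auto dest: inj_onD)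
  then have mem: "\<bar>a k - a l\<bar> \<in> D"
    unfolding D_def using k by (cases "a l < a k") (force simp: abs_if)+
  show "Min D \<le> \<bar>a k - a l\<bar>" using fin mem by (rule Min_le)
  have "Min D \<in> D" using fin mem by (intro Min_in) auto
  then show "0 < Min D" by (auto simp: D_def)
qed

theorem mainTheorem2:
  fixes N :: nat and a :: "nat \<Rightarrow> real"
    and hbar lam \<alpha> \<beta> a0 \<kappa>0 b0 lam0 \<alpha>0 \<alpha>D :: real
    and Psi Phi :: L2R
    and \<rho> :: "nat \<Rightarrow> trace_class"
  assumes "N \<ge> 2"
    and "inj_on a {1..N}"
    and "a0 = Min {a k - a l | k l. k \<in> {1..N} \<and> l \<in> {1..N} \<and> a k > a l}"
    and "hbar > 0" and "lam > 0" and "\<alpha> > 0" and "\<beta> = 2 * lam / \<alpha>"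
    and "norm Psi = 1" and "norm Phi = 1"
    and "\<And>k. k \<in> {1..N} \<Longrightarrow> \<rho> k = pointer_state hbar lam \<beta> Psi Phi (a k)"
    and "\<kappa>0 > 0" and "momentum_limited \<kappa>0 Psi"
    and "AE p in lborel. momentum_wf hbar Psi p \<in> \<real>"
    and "(AE p in lborel. momentum_wf hbar Psi (- p) = momentum_wf hbar Psi p) \<or>
         (AE p in lborel. momentum_wf hbar Psi (- p) = - momentum_wf hbar Psi p)"
    and "b0 > 0" and "momentum_limited b0 Phi"
    and "AE b in lborel. rep_L2R Phi b \<in> \<real>"
    and "lam0 = 2 * hbar * b0 / a0"
    and "\<alpha>0 = 4 * hbar * \<kappa>0 / (a0 - 2 * hbar * b0 / lam)"
    and "\<alpha>D = 2 * hbar * \<kappa>0 / a0"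
  shows "(\<forall>\<eta>. charF hbar \<beta> Psi \<eta> \<in> \<real> \<and> charF hbar \<beta> Psi (- \<eta>) = charF hbar \<beta> Psi \<eta>)
    \<and> (lam > lam0 \<and> \<alpha> > \<alpha>0 \<longrightarrow>
         (\<forall>k\<in>{1..N}. \<forall>l\<in>{1..N}. k \<noteq> l \<longrightarrow>
            Rep_trace_class (\<rho> k) \<circ> Rep_trace_class (\<rho> l) = (\<lambda>_. 0)))
    \<and> (lam > lam0 \<longrightarrow> \<alpha>0 > \<alpha>D)"
proof (intro conjI allI impI ballI)
  have "AE p in lborel. cmod (momentum_wf hbar Psi (- p)) = cmod (momentum_wf hbar Psi p)"
    using assms(14) by (auto elim: eventually_mono)
  then have even: "charF hbar \<beta> Psi (- \<eta>) = charF hbar \<beta> Psi \<eta>" for \<eta> by (rule charF_minus)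
  then show "charF hbar \<beta> Psi (- \<eta>) = charF hbar \<beta> Psi \<eta>" for \<eta> .
  \<comment> \<open>The density is real, so conjugation reverses the sign of \<open>\<eta>\<close>,
    and evenness gives real values.\<close>
  have "cnj (charF hbar \<beta> Psi \<eta>) = charF hbar \<beta> Psi \<eta>" for \<eta> by (simp add: cnj_charF even)
  then show "charF hbar \<beta> Psi \<eta> \<in> \<real>" for \<eta> by (simp add: Reals_cnj_iff)
  \<comment> \<open>The indices 1 and 2, present because \<open>N\<close> is at least 2, witness
    that the set of differences is nonempty.\<close>
  have a0: "0 < a0" and a0_le: "\<And>k l. k \<in> {1..N} \<Longrightarrow> l \<in> {1..N} \<Longrightarrow> k \<noteq> l \<Longrightarrow> a0 \<le> \<bar>a k - a l\<bar>"
    using Min_difference_le[OF assms(2)] Min_difference_le(1)[OF assms(2), of 1 2] assms(1,3) by auto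
  \<comment> \<open>The denominator of \<open>\<alpha>0\<close>: \<open>lam * d\<close> is what
    remains of the separation \<open>lam * a0\<close> after the pointer width
    \<open>2 * hbar * b0\<close> is deducted. It is positive exactly above
    \<open>lam0\<close>.\<close>
  define d where "d = a0 - 2 * hbar * b0 / lam"
  have d: "0 < d" if "lam > lam0"
  proof -
    have "2 * hbar * b0 < lam * a0" using that a0 assms(18) by (simp add: pos_divide_less_eq)
    then show ?thesis using assms(5) by (simp add: d_def pos_divide_less_eq mult.commute)
  qed
  show "\<alpha>D < \<alpha>0" if "lam > lam0"
  proof -
    have "0 < hbar * \<kappa>0" "d \<le> a0" using assms(4,5,11,15) by (simp_all add: d_def)
    \<comment> \<open>Strictness comes from 4 against 2; shrinking the denominator from
      \<open>a0\<close> to \<open>d\<close> only helps.\<close>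
    then have "2 * hbar * \<kappa>0 / a0 < 4 * hbar * \<kappa>0 / a0"
      using a0 by (intro divide_strict_right_mono) linarith+
    also have "\<dots> \<le> 4 * hbar * \<kappa>0 / d"
      using d[OF that] \<open>d \<le> a0\<close> assms(4,11) by (intro divide_left_mono) (simp_all add: a0)
    finally show ?thesis by (simp add: assms(19,20) d_def)
  qed
  fix k l assume "lam > lam0 \<and> \<alpha> > \<alpha>0" and kl: "k \<in> {1..N}" "l \<in> {1..N}" "k \<noteq> l"
  then have lam: "lam > lam0" and \<alpha>: "\<alpha> > \<alpha>0" by auto
  have "4 * hbar * \<kappa>0 < \<alpha> * d"
    using \<alpha> d[OF lam] by (simp add: assms(19) d_def[symmetric] pos_divide_less_eq)
  then have "4 * hbar * \<kappa>0 / \<alpha> < d" using assms(6) by (simp add: pos_divide_less_eq mult.commute)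
  then have "lam * (4 * hbar * \<kappa>0 / \<alpha>) < lam * d"
    using assms(5) by (rule mult_strict_left_mono)
  also have "\<dots> = lam * a0 - 2 * hbar * b0" using assms(5) by (simp add: d_def right_diff_distrib)
  finally have less: "2 * hbar * b0 + lam * (4 * hbar * \<kappa>0 / \<alpha>) < lam * a0" by simp
  \<comment> \<open>Since \<open>\<beta>\<close> is \<open>2 * lam / \<alpha>\<close>, the doubled
    momentum spread contributes the factor 4 seen in \<open>\<alpha>0\<close>.\<close>
  have "2 * hbar * (b0 + \<bar>\<beta>\<bar> * \<kappa>0) = 2 * hbar * b0 + lam * (4 * hbar * \<kappa>0 / \<alpha>)"
    using assms(5,6) by (simp add: assms(7) field_simps)
  also have "\<dots> < lam * a0" by (fact less)
  also have "\<dots> \<le> lam * \<bar>a k - a l\<bar>" using a0_le[OF kl] assms(5) by simp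
  also have "\<dots> = \<bar>lam * a k - lam * a l\<bar>" using assms(5) by (simp add: abs_mult right_diff_distrib[symmetric])
  finally show "Rep_trace_class (\<rho> k) \<circ> Rep_trace_class (\<rho> l) = (\<lambda>_. 0)"
    unfolding assms(10)[OF kl(1)] assms(10)[OF kl(2)]
    by (rule pointer_state_comp_eq_0[OF assms(4,12,16)])
qed

end
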